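(* Let $\mathbb{F}_q$ be a finite field and let $f_1,\ldots,f_r\in\mathbb{F}_q[x_1,\ldots,x_n]$ be polynomials of total degrees $d_1,\ldots,d_r$, with $d=d_1+\cdots+d_r$. Let $z=\{\mathbf{x}\in\mathbb{F}_q^n: f_1(\mathbf{x})=\cdots=f_r(\mathbf{x})=0\}$ and $\mathcal{N}=\# z$. Suppose that $n>d$, that $z$ is non-empty, and that $z$ is not an affine linear subspace of $\mathbb{A}^n(\mathbb{F}_q)=\mathbb{F}_q^n$. Then: (i) for any $q$ we have $\mathcal{N}>q^{n-d}$; (ii) if $q\ge 4$ we have $\mathcal{N}\ge 2q^{n-d}$; (iii) for any $q$, if the polynomials $f_1,\ldots,f_r$ are homogeneous, then $\mathcal{N}\ge q^{n+1-d}/(n+2-d)$.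
   Context: An affine linear subspace of $\mathbb{F}_q^n$ is a translate of a vector subspace (it need not contain the origin). *)

theory Defs
  imports "HOL-Analysis.Cartesian_Space" "HOL-Library.Poly_Mapping"
begin

text \<open>
  Polynomials over \<open>'a\<close> in variables \<open>x\<^sub>i\<close> indexed by a finite type \<open>'n\<close> (so their number
  is \<open>CARD('n)\<close>): finitely supported maps from exponent vectors to coefficients.
\<close>

type_synonym ('n, 'a) mpolynomial = "('n \<Rightarrow>\<^sub>0 nat) \<Rightarrow>\<^sub>0 'a"

definition monomial_degree :: "('n::finite \<Rightarrow>\<^sub>0 nat) \<Rightarrow> nat" where
  "monomial_degree m = (\<Sum>i\<in>UNIV. Poly_Mapping.lookup m i)"

definition mpoly_eval :: "('n::finite, 'a::comm_semiring_1) mpolynomial \<Rightarrow> 'a ^ 'n \<Rightarrow> 'a" where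
  "mpoly_eval p x =
     (\<Sum>m\<in>Poly_Mapping.keys p.
        Poly_Mapping.lookup p m * (\<Prod>i\<in>UNIV. (x $ i) ^ Poly_Mapping.lookup m i))"

text \<open>The zero polynomial gets total degree 0, as for \<open>degree\<close> of univariate polynomials.\<close>

definition total_degree :: "('n::finite, 'a::zero) mpolynomial \<Rightarrow> nat" where
  "total_degree p =
     (if p = 0 then 0 else Max (monomial_degree ` Poly_Mapping.keys p))"

definition homogeneous :: "('n::finite, 'a::zero) mpolynomial \<Rightarrow> bool" where
  "homogeneous p \<longleftrightarrow> (\<exists>k. \<forall>m\<in>Poly_Mapping.keys p. monomial_degree m = k)"

definition common_zeros ::
    "nat \<Rightarrow> (nat \<Rightarrow> ('n::finite, 'a::comm_semiring_1) mpolynomial) \<Rightarrow> ('a ^ 'n) set" where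
  "common_zeros r f = {x. \<forall>i\<in>{1..r}. mpoly_eval (f i) x = 0}"

text \<open>The library's \<open>affine\<close> is only available over the reals.\<close>

definition affine_linear_subspace :: "('a::field ^ 'n::finite) set \<Rightarrow> bool" where
  "affine_linear_subspace S \<longleftrightarrow> (\<exists>a V. vec.subspace V \<and> S = (\<lambda>v. a + v) ` V)"

end

theory Submission
  imports Defs "HOL-Number_Theory.Number_Theory" "HOL-Algebra.Multiplicative_Group"
    "HOL-Algebra.Sylow" "HOL-Computational_Algebra.Polynomial"
begin

text \<open>
  Two facts about the intersections of \<open>z\<close> with the cosets of a \<open>d\<close>-dimensional subspace \<open>W\<close> drive
  the proof. First, following Ax, their cardinalities are congruent modulo \<open>q\<close>: expand the
  indicator function of \<open>z\<close> in Teichmueller representatives over an unramified extension of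
  \<open>\<int>/p\<^sup>k\<close>, where \<open>q = p\<^sup>k\<close>, and compare the \<open>p\<close>-adic valuations of multinomial coefficients with
  the degrees. Second, by the usual degree argument over the field itself, the sum of the points of
  \<open>z\<close> in \<open>u + W\<close> is an affine function of \<open>u\<close>. So if each coset of \<open>W\<close> contains \<open>1\<close> point modulo \<open>q\<close>,
  there is an affine subspace \<open>V\<close> of size \<open>Q = q\<^sup>n\<^sup>-\<^sup>d\<close> such that every coset through a point of
  \<open>V - z\<close> contains at least \<open>q + 1\<close> points of \<open>z\<close>.

  If \<open>z\<close> is small, a counting argument extends a point of \<open>z\<close> (for a cone: the origin) to such a
  \<open>W\<close>. In case (i) this gives \<open>z = V\<close>. In cases (ii) and (iii) most of \<open>V\<close> lies in \<open>z\<close>; take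
  \<open>v \<in> z - V\<close> and a \<open>(d - 1)\<close>-dimensional \<open>U\<close> in general position. The \<open>d\<close>-dimensional affine spaces
  spanned by \<open>v + U\<close> and a point \<open>y \<in> V \<inter> z\<close> meet \<open>z\<close> in two points at least, hence in about \<open>q\<close>
  points by the congruence, and they are disjoint outside \<open>v + U\<close>; so \<open>z\<close> has about \<open>q Q\<close> points.
\<close>

subsection \<open>Multinomial coefficients and digit sums\<close>

text \<open>The multinomial theorem as an induction principle. A coefficient enters only through
  \<open>c * (\<Prod>j\<in>A. fact (a j)) = fact K\<close>, the form to which Legendre's formula
  applies, and \<open>P\<close> speaks of functions of \<open>x\<close> because it will be
  instantiated with the class \<open>admissible\<close>.\<close>

lemma multinomial_expansion_induct:
  fixes y :: "'j \<Rightarrow> 'x \<Rightarrow> 'r::comm_ring_1"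
  assumes "finite A"
    and "P (\<lambda>x. 0)"
    and "\<And>G H. P G \<Longrightarrow> P H \<Longrightarrow> P (\<lambda>x. G x + H x)"
    and "\<And>a c. (\<Sum>j\<in>A. a j) = K \<Longrightarrow> c * (\<Prod>j\<in>A. fact (a j)) = (fact K :: nat)
           \<Longrightarrow> P (\<lambda>x. of_nat c * (\<Prod>j\<in>A. y j x ^ a j))"
  shows "P (\<lambda>x. (\<Sum>j\<in>A. y j x) ^ K)"
  using assms
proof (induction A arbitrary: K P rule: finite_induct)
  case empty
  show ?case
  proof (cases "K = 0")
    case True
    then show ?thesis using empty(3)[of "\<lambda>_. 0" 1] by simp
  next
    case False
    then show ?thesis using empty(1) by (simp add: power_0_left)
  qed
next
  case (insert j0 A)
  have sumP: "P (\<lambda>x. \<Sum>i\<in>I. G i x)" if "finite I" "\<And>i. i \<in> I \<Longrightarrow> P (G i)" for I :: "nat set" and G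
    using that
  proof (induction I rule: finite_induct)
    case empty
    then show ?case using insert.prems(1) by simp
  next
    case (insert i I)
    then show ?case using insert.prems insert.hyps insert.IH
      by (simp add: \<open>\<And>G H. P G \<Longrightarrow> P H \<Longrightarrow> P (\<lambda>x. G x + H x)\<close>)
  qed
  have "P (\<lambda>x. \<Sum>i\<le>K. of_nat (K choose i) * y j0 x ^ i * (\<Sum>j\<in>A. y j x) ^ (K - i))"
  proof (rule sumP)
    fix i assume "i \<in> {..K}"
    then have iK: "i \<le> K" by simp
    show "P (\<lambda>x. of_nat (K choose i) * y j0 x ^ i * (\<Sum>j\<in>A. y j x) ^ (K - i))"
    \<comment> \<open>The induction on \<open>A\<close> is generalised over \<open>P\<close>, so the
      factor coming from the binomial expansion can be absorbed into the predicate.\<close>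
    proof (rule insert.IH[where P = "\<lambda>G. P (\<lambda>x. of_nat (K choose i) * y j0 x ^ i * G x)"])
      show "P (\<lambda>x. of_nat (K choose i) * y j0 x ^ i * 0)" using insert.prems(1) by simp
      show "P (\<lambda>x. of_nat (K choose i) * y j0 x ^ i * (G x + H x))"
        if "P (\<lambda>x. of_nat (K choose i) * y j0 x ^ i * G x)"
           "P (\<lambda>x. of_nat (K choose i) * y j0 x ^ i * H x)" for G H
        using insert.prems(2)[OF that] by (simp add: distrib_left)
      fix a :: "'j \<Rightarrow> nat" and c :: nat
      assume a: "(\<Sum>j\<in>A. a j) = K - i" and c: "c * (\<Prod>j\<in>A. fact (a j)) = fact (K - i)"
      have s: "(\<Sum>j\<in>insert j0 A. (a(j0 := i)) j) = K"
      proof -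
        have "(\<Sum>j\<in>A. (a(j0 := i)) j) = (\<Sum>j\<in>A. a j)"
          using insert.hyps by (intro sum.cong) auto
        then show ?thesis using insert.hyps a iK by simp
      qed
      have pr: "(\<Prod>j\<in>A. fact ((a(j0 := i)) j)) = (\<Prod>j\<in>A. fact (a j) :: nat)"
        using insert.hyps by (intro prod.cong) auto
      have "((K choose i) * c) * (\<Prod>j\<in>insert j0 A. fact ((a(j0 := i)) j))
          = (K choose i) * fact i * (c * (\<Prod>j\<in>A. fact (a j)))"
        using insert.hyps pr by simp
      also have "\<dots> = fact K"
        unfolding c using binomial_fact_lemma[OF iK] by (simp add: ac_simps)
      finally have cc: "((K choose i) * c) * (\<Prod>j\<in>insert j0 A. fact ((a(j0 := i)) j)) = (fact K :: nat)" .
      have pr2: "(\<Prod>j\<in>A. y j x ^ ((a(j0 := i)) j)) = (\<Prod>j\<in>A. y j x ^ a j)" for x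
        using insert.hyps by (intro prod.cong) auto
      show "P (\<lambda>x. of_nat (K choose i) * y j0 x ^ i * (of_nat c * (\<Prod>j\<in>A. y j x ^ a j)))"
        using insert.prems(3)[OF s cc] insert.hyps
        by (simp add: pr2 ac_simps del: fun_upd_apply) (simp add: ac_simps)
    qed
  qed simp
  then show ?case using insert.hyps by (simp add: binomial_ring)
qed

section \<open>Digit sums in base \<open>p\<close> and Legendre's formula\<close>

function digit_sum :: "nat \<Rightarrow> nat \<Rightarrow> nat" where
  "digit_sum p n = (if p < 2 \<or> n = 0 then 0 else n mod p + digit_sum p (n div p))"
  by auto
termination by (relation "measure snd") auto

declare digit_sum.simps [simp del]

lemma digit_sum_0 [simp]: "digit_sum p 0 = 0"
  by (simp add: digit_sum.simps)

lemma digit_sum_mult_add: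
  assumes "p \<ge> 2" "r < p"
  shows "digit_sum p (p * n + r) = digit_sum p n + r"
  using assms by (subst digit_sum.simps) (auto simp: digit_sum.simps[of p 0])

lemma digit_sum_mult_power:
  assumes "p \<ge> 2"
  shows "digit_sum p (n * p ^ a) = digit_sum p n"
proof (induction a)
  case (Suc a)
  then show ?case using digit_sum_mult_add[of p 0 "n * p ^ a"] assms by (simp add: ac_simps)
qed simp

lemma digit_sum_power_minus_1:
  assumes "p \<ge> 2"
  shows "digit_sum p (p ^ k - 1) = k * (p - 1)"
proof (induction k)
  case (Suc k)
  have "p ^ k \<ge> 1" using assms by simp
  then have "p * p ^ k \<ge> p" by simp
  then have "p ^ Suc k - 1 = p * (p ^ k - 1) + (p - 1)"
    using assms by (simp add: diff_mult_distrib2)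
  then show ?case using Suc digit_sum_mult_add[of p "p - 1" "p ^ k - 1"] assms
    by (simp add: add.commute)
qed simp

text \<open>Adding 1 turns each of the trailing digits \<open>p - 1\<close> of \<open>n\<close> into
  \<open>0\<close> and raises the next digit by 1; the number of these trailing digits is the
  multiplicity of \<open>p\<close> in \<open>Suc n\<close>.\<close>

lemma digit_sum_Suc:
  assumes "prime p"
  shows "digit_sum p (Suc n) + (p - 1) * multiplicity p (Suc n) = digit_sum p n + 1"
proof (induction n rule: less_induct)
  case (less n)
  have p: "p \<ge> 2" using assms by (simp add: prime_ge_2_nat)
  show ?case
  proof (cases "p dvd Suc n")
    case False
    define a b where "a = n div p" and "b = n mod p"
    have n: "n = p * a + b" and "b < p" using p by (auto simp: a_def b_def)
    moreover have "b \<noteq> p - 1"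
    proof
      assume "b = p - 1"
      then have "Suc n = p * (a + 1)" using n p by simp
      then show False using False by (metis dvd_triv_left)
    qed
    ultimately have "digit_sum p (Suc n) = digit_sum p a + Suc b" "digit_sum p n = digit_sum p a + b"
      using digit_sum_mult_add[of p "Suc b" a] digit_sum_mult_add[of p b a] p by auto
    then show ?thesis using False by (simp add: not_dvd_imp_multiplicity_0)
  next
    case True
    then obtain u where u: "Suc n = p * u" by blast
    then obtain w where w: "u = Suc w" by (cases u) auto
    have n: "n = p * w + (p - 1)" using u w p by simp
    have "w \<le> p * w" using p by simp
    then have "w < n" using n p by linarith
    have 1: "digit_sum p (Suc n) = digit_sum p (Suc w)"
      using digit_sum_mult_add[of p 0 u] u w p by simp
    have 2: "digit_sum p n = digit_sum p w + (p - 1)"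
      using digit_sum_mult_add[of p "p - 1" w] n p by simp
    have 3: "multiplicity p (Suc n) = Suc (multiplicity p (Suc w))"
      using u w multiplicity_times_same[of u p] p by simp
    have "(p - 1) * multiplicity p (Suc n) = (p - 1) * multiplicity p (Suc w) + (p - 1)"
      by (simp add: 3)
    then show ?thesis using less.IH[OF \<open>w < n\<close>] 1 2 by linarith
  qed
qed

text \<open>Legendre's formula, written without subtraction: the changes of the digit sum at the
  successive steps up to \<open>n\<close> are added up.\<close>

lemma legendre_digit_sum:
  assumes "prime p"
  shows "(p - 1) * multiplicity p (fact n :: nat) + digit_sum p n = n"
proof (induction n)
  case (Suc n)
  have "multiplicity p (fact (Suc n) :: nat) = multiplicity p (Suc n) + multiplicity p (fact n :: nat)"
    using assms prime_elem_multiplicity_mult_distrib[of p "Suc n" "fact n"] by (simp del: mult_Suc)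
  then show ?case using Suc digit_sum_Suc[OF assms, of n] by (simp add: algebra_simps)
qed simp

text \<open>Legendre's formula is applied to \<open>K\<close> and to every \<open>a j\<close>; since
  the \<open>a j\<close> add up to \<open>K\<close>, only digit sums remain.\<close>

lemma multiplicity_multinomial:
  assumes "prime p" "finite A" and K: "(\<Sum>j\<in>A. a j) = K"
    and c: "c * (\<Prod>j\<in>A. fact (a j)) = (fact K :: nat)"
  shows "(p - 1) * multiplicity p c + digit_sum p K = (\<Sum>j\<in>A. digit_sum p (a j))"
proof -
  have "c \<noteq> 0" using c by (metis fact_nonzero mult_zero_left)
  have "multiplicity p (\<Prod>j\<in>A. fact (a j) :: nat) = (\<Sum>j\<in>A. multiplicity p (fact (a j) :: nat))"
    by (rule prime_elem_multiplicity_prod_distrib) (use assms in auto)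
  then have m: "multiplicity p (fact K :: nat) = multiplicity p c + (\<Sum>j\<in>A. multiplicity p (fact (a j) :: nat))"
    unfolding c[symmetric] using assms(1,2) \<open>c \<noteq> 0\<close>
    by (subst prime_elem_multiplicity_mult_distrib) auto
  have "(\<Sum>j\<in>A. (p - 1) * multiplicity p (fact (a j) :: nat) + digit_sum p (a j)) = K"
    by (simp only: legendre_digit_sum[OF assms(1)] K)
  then have "(p - 1) * (\<Sum>j\<in>A. multiplicity p (fact (a j) :: nat)) + (\<Sum>j\<in>A. digit_sum p (a j)) = K"
    by (simp add: sum.distrib sum_distrib_left)
  then show ?thesis using legendre_digit_sum[OF assms(1), of K] m by (simp add: algebra_simps)
qed

text \<open>The representative of \<open>e\<close> modulo \<open>q - 1\<close> in \<open>{1..q-1}\<close>, except that \<open>0\<close> is kept apart from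
  the positive multiples of \<open>q - 1\<close>: \<open>x ^ e\<close> and \<open>x ^ reduced_exp q e\<close> agree on the field with
  \<open>q\<close> elements, including at \<open>x = 0\<close>.\<close>

definition reduced_exp :: "nat \<Rightarrow> nat \<Rightarrow> nat" where
  "reduced_exp q e = (if e = 0 then 0 else (e - 1) mod (q - 1) + 1)"

section \<open>Subadditivity of reduced exponents\<close>

lemma reduced_exp_0 [simp]: "reduced_exp q 0 = 0"
  by (simp add: reduced_exp_def)

lemma reduced_exp_pos: "e > 0 \<Longrightarrow> reduced_exp q e > 0"
  by (simp add: reduced_exp_def)

lemma reduced_exp_cong: "[reduced_exp q e = e] (mod (q - 1))"
proof (cases "e = 0")
  case False
  have "[(e - 1) mod (q - 1) + 1 = (e - 1) + 1] (mod (q - 1))"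
    by (intro cong_add) (auto simp: cong_def)
  then show ?thesis using False by (simp add: reduced_exp_def)
qed simp

text \<open>Minimality among the representatives of \<open>e\<close> modulo \<open>q - 1\<close>
  that are positive if \<open>e\<close> is. Subadditivity follows, because a sum of reduced
  exponents is such a representative of the sum.\<close>

lemma reduced_exp_le:
  assumes "q \<ge> 2" "[x = e] (mod (q - 1))" "e > 0 \<Longrightarrow> x > 0"
  shows "reduced_exp q e \<le> x"
proof (cases "e = 0")
  case False
  then have x: "x > 0" using assms by simp
  then have "[x - 1 = e - 1] (mod (q - 1))"
    using assms(2) False cong_add_rcancel_nat[of "x - 1" 1 "e - 1" "q - 1"] by simp
  then have "(e - 1) mod (q - 1) = (x - 1) mod (q - 1)" by (simp add: cong_def)
  also have "\<dots> \<le> x - 1" by simp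
  finally show ?thesis using False x by (simp add: reduced_exp_def)
qed simp

lemma reduced_exp_eq:
  assumes "[x = e] (mod (q - 1))" "e > 0 \<longleftrightarrow> x > 0"
  shows "reduced_exp q x = reduced_exp q e"
proof (cases "e = 0")
  case False
  then have x: "x > 0" using assms by simp
  then have "[x - 1 = e - 1] (mod (q - 1))"
    using assms(1) False cong_add_rcancel_nat[of "x - 1" 1 "e - 1" "q - 1"] by simp
  then show ?thesis using False x by (simp add: reduced_exp_def cong_def)
qed (use assms in auto)

lemma reduced_exp_add_le:
  assumes "q \<ge> 2"
  shows "reduced_exp q (a + b) \<le> reduced_exp q a + reduced_exp q b"
  using assms cong_add[OF reduced_exp_cong[of q a] reduced_exp_cong[of q b]]
  by (intro reduced_exp_le) (auto simp: reduced_exp_def)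

lemma reduced_exp_sum_le:
  assumes "q \<ge> 2" "finite A"
  shows "reduced_exp q (\<Sum>j\<in>A. a j) \<le> (\<Sum>j\<in>A. reduced_exp q (a j))"
  using assms(2)
proof (induction A rule: finite_induct)
  case (insert j A)
  then show ?case using reduced_exp_add_le[OF assms(1), of "a j" "sum a A"] by simp
qed simp

lemma reduced_exp_mult_le:
  assumes "q \<ge> 2"
  shows "reduced_exp q (a * b) \<le> a * reduced_exp q b"
proof (induction a)
  case (Suc a)
  then show ?case using reduced_exp_add_le[OF assms, of b "a * b"] by simp
qed simp

lemma reduced_exp_of_multiple:
  assumes "q \<ge> 2" "(q - 1) dvd e" "e > 0"
  shows "reduced_exp q e = q - 1"
proof -
  have "reduced_exp q e = reduced_exp q (q - 1)"
    using assms by (intro reduced_exp_eq) (auto simp: cong_def)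
  also have "\<dots> = q - 1" using assms by (simp add: reduced_exp_def)
  finally show ?thesis .
qed

text \<open>The sum runs over the Frobenius twists of the exponent \<open>n\<close>. It is
  subadditive in \<open>n\<close>, it is unchanged when \<open>n\<close> is replaced by
  \<open>p * n\<close> since \<open>p ^ k\<close> is 1 modulo \<open>q - 1\<close> and the summands
  are shifted cyclically, and its value at 1 is \<open>(q - 1) / (p - 1)\<close>. Splitting off the
  base \<open>p\<close> digits of \<open>n\<close> one by one gives the bound.\<close>

lemma sum_reduced_exp_le_digit_sum:
  assumes p: "p \<ge> 2" and q: "q = p ^ k" and k: "k \<ge> 1"
  shows "(p - 1) * (\<Sum>h<k. reduced_exp q (p ^ h * n)) \<le> (q - 1) * digit_sum p n"
proof (induction n rule: less_induct)
  case (less n)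
  have q2: "q \<ge> 2" using p power_increasing[OF k, of p] by (simp add: q)
  define L where "L n = (\<Sum>h<k. reduced_exp q (p ^ h * n))" for n
  have Lmult: "L (p * n) = L n" for n
  proof -
    have "reduced_exp q (p ^ k * n) = reduced_exp q (p ^ 0 * n)"
    proof (rule reduced_exp_eq)
      have "[q - 1 + 1 = 0 + 1] (mod (q - 1))" by (intro cong_add) (auto simp: cong_def)
      then have "[q = 1] (mod (q - 1))" using q2 by simp
      then show "[p ^ k * n = p ^ 0 * n] (mod (q - 1))"
        using cong_scalar_right[of q 1 "q - 1" n] by (simp add: q)
    qed (use p in auto)
    moreover have "L (p * n) = (\<Sum>h<k. reduced_exp q (p ^ Suc h * n))"
      by (simp add: L_def ac_simps)
    moreover have "(\<Sum>h<k. reduced_exp q (p ^ Suc h * n)) + reduced_exp q (p ^ 0 * n)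
       = (\<Sum>h<k. reduced_exp q (p ^ h * n)) + reduced_exp q (p ^ k * n)"
      using sum.lessThan_Suc[of "\<lambda>h. reduced_exp q (p ^ h * n)" k]
        sum.lessThan_Suc_shift[of "\<lambda>h. reduced_exp q (p ^ h * n)" k] by linarith
    ultimately show ?thesis by (simp add: L_def)
  qed
  have Ladd: "L (a + b) \<le> L a + L b" for a b
    unfolding L_def sum.distrib[symmetric] distrib_left
    by (intro sum_mono reduced_exp_add_le q2)
  have rp: "reduced_exp q (p ^ h) = p ^ h" if "h < k" for h
  proof -
    have "p ^ h < q" "p ^ h > 0" using power_strict_increasing[OF that, of p] p q by auto
    then have "p ^ h - 1 < q - 1" by linarith
    then show ?thesis using \<open>p ^ h > 0\<close> by (simp add: reduced_exp_def)
  qed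
  have gp: "(p - 1) * (\<Sum>h<j. p ^ h) + 1 = p ^ j" for j
  proof (induction j)
    case (Suc j)
    have "(p - 1) * (\<Sum>h<Suc j. p ^ h) + 1 = (p - 1) * p ^ j + p ^ j"
      using Suc by (simp add: distrib_left)
    also have "\<dots> = p ^ Suc j" using p by (simp add: diff_mult_distrib)
    finally show ?case .
  qed simp
  have "L 1 = (\<Sum>h<k. p ^ h)" by (simp add: L_def rp)
  then have L1: "(p - 1) * L 1 = q - 1"
    using gp[of k] q by simp
  have Lr: "L r \<le> r * L 1" for r
  proof (induction r)
    case 0
    show ?case by (simp add: L_def)
  next
    case (Suc r)
    then show ?case using Ladd[of 1 r] by simp
  qed
  show ?case
  proof (cases "n = 0")
    case False
    define a b where "a = n div p" and "b = n mod p"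
    have n: "n = p * a + b" and "b < p" using p by (auto simp: a_def b_def)
    have "a < n" using False p by (simp add: a_def)
    have "(p - 1) * L n \<le> (p - 1) * (L a + b * L 1)"
      using Ladd[of "p * a" b] Lmult[of a] Lr[of b] n by (intro mult_left_mono) auto
    also have "\<dots> = (p - 1) * L a + b * (q - 1)" unfolding L1[symmetric] by (simp add: algebra_simps)
    also have "\<dots> \<le> (q - 1) * digit_sum p a + b * (q - 1)"
      using less.IH[OF \<open>a < n\<close>] by (simp add: L_def)
    also have "\<dots> = (q - 1) * digit_sum p n"
      using digit_sum_mult_add[OF p \<open>b < p\<close>, of a] n by (simp add: algebra_simps)
    finally show ?thesis by (simp add: L_def)
  qed simp
qed

subsection \<open>Finite fields\<close>

lemma finite_field_power_card_minus_1:
  fixes a :: "'a::{field,finite}"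
  assumes "a \<noteq> 0"
  shows "a ^ (CARD('a) - 1) = 1"
proof -
  have "(\<Prod>x\<in>-{0::'a}. x) = (\<Prod>x\<in>-{0}. a * x)"
    by (rule prod.reindex_bij_witness[of _ "\<lambda>x. a * x" "\<lambda>x. x / a"]) (use assms in auto)
  also have "\<dots> = a ^ card (-{0::'a}) * (\<Prod>x\<in>-{0}. x)"
    by (simp add: prod.distrib)
  finally have "a ^ card (-{0::'a}) = 1" by simp
  then show ?thesis by (simp add: Compl_eq_Diff_UNIV)
qed

lemma finite_field_card_ge_2: "CARD('a::{field,finite}) \<ge> 2"
  using card_mono[of "UNIV :: 'a set" "{0,1}"] by simp

lemma finite_field_power_card:
  fixes a :: "'a::{field,finite}"
  shows "a ^ CARD('a) = a"
proof (cases "a = 0")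
  case False
  have "a ^ CARD('a) = a ^ (CARD('a) - 1) * a"
    using finite_field_card_ge_2[where 'a='a] by (metis One_nat_def Suc_pred power_Suc2 zero_less_card_finite)
  then show ?thesis using finite_field_power_card_minus_1[OF False] by simp
qed (simp add: power_0_left)

lemma finite_field_power_card_power:
  fixes a :: "'a::{field,finite}"
  shows "a ^ (CARD('a) ^ k) = a"
  by (induction k) (simp_all add: power_mult finite_field_power_card)

text \<open>Otherwise the polynomial \<open>X^c - 1\<close>, with \<open>c\<close> the residue of
  \<open>e\<close> modulo \<open>CARD('a) - 1\<close>, would vanish at all nonzero elements, which
  are more than its degree allows.\<close>

lemma finite_field_exists_power_neq_1:
  assumes "\<not> (CARD('a::{field,finite}) - 1) dvd e"
  shows "\<exists>b::'a. b \<noteq> 0 \<and> b ^ e \<noteq> 1"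
proof (rule ccontr)
  assume "\<not> ?thesis"
  then have *: "b ^ e = 1" if "b \<noteq> 0" for b :: 'a using that by blast
  define c where "c = e mod (CARD('a) - 1)"
  have c: "c > 0" using assms by (simp add: c_def mod_greater_zero_iff_not_dvd)
  have "CARD('a) - 1 > 0" using finite_field_card_ge_2[where 'a='a] by simp
  then have cq: "c < CARD('a) - 1" unfolding c_def by simp
  have bc: "b ^ c = 1" if "b \<noteq> 0" for b :: 'a
  proof -
    have "b ^ e = (b ^ (CARD('a) - 1)) ^ (e div (CARD('a) - 1)) * b ^ c"
      by (simp add: c_def flip: power_mult power_add)
    then show ?thesis using *[OF that] finite_field_power_card_minus_1[OF that] by simp
  qed
  define P :: "'a poly" where "P = Polynomial.monom 1 c - 1"
  have P: "P \<noteq> 0"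
    using c by (auto simp: P_def poly_eq_iff coeff_monom dest!: spec[of _ c])
  have "Polynomial.degree P \<le> c" unfolding P_def by (intro degree_diff_le) (auto simp: degree_monom_le)
  moreover have "-{0} \<subseteq> {x. poly P x = 0}" by (auto simp: P_def poly_monom bc)
  then have "CARD('a) - 1 \<le> card {x. poly P x = 0}"
    using card_mono[of "{x. poly P x = 0}" "-{0::'a}"] by (simp add: Compl_eq_Diff_UNIV)
  moreover have "card {x. poly P x = 0} \<le> Polynomial.degree P" by (rule card_poly_roots_bound[OF P])
  ultimately show False using cq by linarith
qed

text \<open>A prime \<open>r\<close> dividing the order of the additive group yields a subgroup of
  order \<open>r\<close>, hence a nonzero \<open>x\<close> that is annihilated by \<open>r\<close>;
  so \<open>r\<close> is the characteristic, and no other prime divides the order.\<close>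

lemma finite_field_card_prime_power:
  "\<exists>k\<ge>1. CARD('a::{field,finite}) = CHAR('a) ^ k"
proof -
  define G where "G = \<lparr>carrier = (UNIV :: 'a set), monoid.mult = ((+) :: 'a \<Rightarrow> 'a \<Rightarrow> 'a), one = 0\<rparr>"
  have p: "prime CHAR('a)" by (rule prime_CHAR_semidom) (simp add: finite_imp_CHAR_pos)
  have G: "group G"
  proof (rule groupI)
    fix x assume "x \<in> carrier G"
    then show "\<exists>y\<in>carrier G. y \<otimes>\<^bsub>G\<^esub> x = \<one>\<^bsub>G\<^esub>"
      by (intro bexI[of _ "- x"]) (auto simp: G_def)
  qed (auto simp: G_def add.assoc)
  have pow: "x [^]\<^bsub>G\<^esub> n = of_nat n * x" for x and n :: nat
    by (induction n) (auto simp: G_def nat_pow_def algebra_simps)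
  have "r = CHAR('a)" if r: "prime r" "r dvd CARD('a)" for r
  proof -
    \<comment> \<open>With exponent 1, and \<open>s\<close> possibly divisible by \<open>r\<close>,
      Sylow's theorem specialises to Cauchy's theorem.\<close>
    obtain s where s: "CARD('a) = r ^ 1 * s" using r by auto
    have "Coset.order G = r ^ 1 * s" "finite (carrier G)" using s by (auto simp: G_def Coset.order_def)
    then obtain H where H: "subgroup H G" "card H = r"
      using sylow_thm[of r G 1 s] r(1) G by auto
    have "card H \<noteq> 1" using H r(1) by auto
    then obtain x where x: "x \<in> H" "x \<noteq> 0"
      by (metis H(2) card_1_singleton_iff is_singletonI is_singletonI' is_singleton_altdef
          not_prime_0 r(1) card.empty is_singleton_def singletonD)
    interpret HG: group "G\<lparr>carrier := H\<rparr>" using subgroup.subgroup_is_group[OF H(1) G] .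
    have "x [^]\<^bsub>G\<lparr>carrier := H\<rparr>\<^esub> Coset.order (G\<lparr>carrier := H\<rparr>) = \<one>\<^bsub>G\<lparr>carrier := H\<rparr>\<^esub>"
      by (rule HG.pow_order_eq_1) (use x in auto)
    then have "x [^]\<^bsub>G\<^esub> r = 0"
      using H(2) by (simp add: Coset.order_def nat_pow_def G_def)
    then have "of_nat r = (0::'a)" using pow x by simp
    then have "CHAR('a) dvd r" by (simp add: of_nat_eq_0_iff_char_dvd)
    then show ?thesis using r(1) p primes_dvd_imp_eq by metis
  qed
  then have "prime_factors CARD('a) \<subseteq> {CHAR('a)}" by (auto simp: in_prime_factors_iff)
  then have pf: "prime_factors CARD('a) = {CHAR('a)}"
    using CHAR_dvd_CARD[where 'a='a] p by (auto simp: in_prime_factors_iff)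
  have "CARD('a) = (\<Prod>r\<in>prime_factors CARD('a). r ^ multiplicity r CARD('a))"
    by (rule prime_factorization_nat) simp
  then have e: "CARD('a) = CHAR('a) ^ multiplicity CHAR('a) CARD('a)" by (simp add: pf)
  moreover have "multiplicity CHAR('a) CARD('a) \<noteq> 0"
  proof
    assume "multiplicity CHAR('a) CARD('a) = 0"
    then have "CARD('a) = 1" using e by simp
    then show False using finite_field_card_ge_2[where 'a='a] by simp
  qed
  ultimately show ?thesis by (metis One_nat_def Suc_leI neq0_conv)
qed

lemma finite_field_generator:
  "\<exists>g::'a::{field,finite}. \<forall>x. x \<noteq> 0 \<longrightarrow> (\<exists>i::nat. x = g ^ i)"
proof -
  define R where "R = \<lparr>carrier = (UNIV :: 'a set), monoid.mult = ((*) :: 'a \<Rightarrow> 'a \<Rightarrow> 'a), one = 1, ring.zero = 0,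
    add = ((+) :: 'a \<Rightarrow> 'a \<Rightarrow> 'a)\<rparr>"
  have cr: "cring R"
  proof (rule cringI)
    show "abelian_group R"
    proof (rule abelian_groupI)
      fix x assume "x \<in> carrier R"
      then show "\<exists>y\<in>carrier R. y \<oplus>\<^bsub>R\<^esub> x = \<zero>\<^bsub>R\<^esub>"
        by (intro bexI[of _ "- x"]) (auto simp: R_def)
    qed (auto simp: R_def algebra_simps)
    show "comm_monoid R" by (rule comm_monoidI) (auto simp: R_def algebra_simps)
  qed (auto simp: R_def algebra_simps)
  have "field R"
  proof (rule cring.cring_fieldI2[OF cr])
    fix a assume "a \<in> carrier R" "a \<noteq> \<zero>\<^bsub>R\<^esub>"
    then show "\<exists>b\<in>carrier R. a \<otimes>\<^bsub>R\<^esub> b = \<one>\<^bsub>R\<^esub>"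
      by (intro bexI[of _ "inverse a"]) (auto simp: R_def)
  qed (auto simp: R_def)
  then obtain g where g: "carrier (mult_of R) = {g [^]\<^bsub>R\<^esub> i | i::nat. i \<in> UNIV}"
    using field.finite_field_mult_group_has_gen[of R] by (auto simp: R_def)
  have pow: "x [^]\<^bsub>R\<^esub> n = x ^ n" for x and n :: nat
    by (induction n) (auto simp: R_def nat_pow_def)
  have "x \<in> carrier (mult_of R)" if "x \<noteq> 0" for x using that by (auto simp: R_def)
  then show ?thesis using g pow by auto
qed

subsection \<open>Teichmueller representatives\<close>

text \<open>\<open>\<pi>\<close> is the reduction to the residue field, and \<open>J i\<close>
  stands for \<open>p\<^sup>i\<close> times the ring of integers of an unramified extension of the
  \<open>p\<close>-adic numbers. Congruences will be read modulo \<open>J k\<close>, with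
  \<open>k\<close> the exponent in \<open>q = p ^ k\<close>, so that \<open>J_int\<close> turns them
  into congruences of integers modulo \<open>q\<close>.\<close>

locale unramified_filtration =
  fixes \<pi> :: "'r::comm_ring_1 \<Rightarrow> 'a::{field,finite}"
    and J :: "nat \<Rightarrow> 'r set"
    and p q k :: nat
  assumes p_def: "p = CHAR('a)" and q_def: "q = CARD('a)" and q_eq: "q = p ^ k" and k_pos: "k \<ge> 1"
    and \<pi>_add: "\<pi> (x + y) = \<pi> x + \<pi> y"
    and \<pi>_mult: "\<pi> (x * y) = \<pi> x * \<pi> y"
    and \<pi>_1: "\<pi> 1 = 1"
    and \<pi>_surj: "\<exists>x. \<pi> x = a"
    and J_0: "J 0 = UNIV"
    and J_1_iff: "x \<in> J 1 \<longleftrightarrow> \<pi> x = 0"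
    and J_add: "x \<in> J i \<Longrightarrow> y \<in> J i \<Longrightarrow> x + y \<in> J i"
    and J_mult: "x \<in> J i \<Longrightarrow> y \<in> J j \<Longrightarrow> x * y \<in> J (i + j)"
    and J_Suc: "J (Suc i) \<subseteq> J i"
    and zero_in_J: "0 \<in> J i"
    and J_int: "of_int c \<in> J i \<Longrightarrow> int (p ^ i) dvd c"
begin

lemma q_ge_2: "q \<ge> 2"
  unfolding q_def by (rule finite_field_card_ge_2)

lemma prime_p: "prime p"
  unfolding p_def by (rule prime_CHAR_semidom) (simp add: finite_imp_CHAR_pos)

lemma J_mult_left: "x \<in> J i \<Longrightarrow> c * x \<in> J i"
  using J_mult[of c 0 x i] by (simp add: J_0)

lemma J_uminus: "x \<in> J i \<Longrightarrow> - x \<in> J i"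
  using J_mult_left[of x i "- 1"] by simp

lemma J_diff: "x \<in> J i \<Longrightarrow> y \<in> J i \<Longrightarrow> x - y \<in> J i"
  using J_add[of x i "- y"] J_uminus[of y i] by simp

lemma J_antimono: "i \<le> j \<Longrightarrow> J j \<subseteq> J i"
  by (rule lift_Suc_antimono_le[of J]) (use J_Suc in auto)

lemma J_sum: "(\<And>x. x \<in> A \<Longrightarrow> f x \<in> J i) \<Longrightarrow> sum f A \<in> J i"
  by (induction A rule: infinite_finite_induct) (auto intro: zero_in_J J_add)

lemma J_power: "x \<in> J 1 \<Longrightarrow> x ^ i \<in> J i"
proof (induction i)
  case (Suc i)
  then show ?case using J_mult[of x 1 "x ^ i" i] by simp
qed (simp add: J_0)

lemma \<pi>_0: "\<pi> 0 = 0"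
  using J_1_iff zero_in_J by blast

lemma \<pi>_diff: "\<pi> (x - y) = \<pi> x - \<pi> y"
  using \<pi>_add[of "x - y" y] by simp

lemma \<pi>_power: "\<pi> (x ^ i) = \<pi> x ^ i"
  by (induction i) (simp_all add: \<pi>_1 \<pi>_mult)

lemma \<pi>_sum: "\<pi> (sum f A) = (\<Sum>x\<in>A. \<pi> (f x))"
  by (induction A rule: infinite_finite_induct) (simp_all add: \<pi>_0 \<pi>_add)

lemma \<pi>_prod: "\<pi> (prod f A) = (\<Prod>x\<in>A. \<pi> (f x))"
  by (induction A rule: infinite_finite_induct) (simp_all add: \<pi>_1 \<pi>_mult)

lemma \<pi>_of_nat: "\<pi> (of_nat i) = of_nat i"
  by (induction i) (simp_all add: \<pi>_0 \<pi>_1 \<pi>_add)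

lemma of_nat_p_power_in_J: "of_nat p ^ i \<in> J i"
  by (intro J_power) (simp add: J_1_iff \<pi>_of_nat p_def del: One_nat_def)

text \<open>The difference of powers is \<open>x - y\<close> times a sum of \<open>p\<close> terms.
  Modulo \<open>J 1\<close> these terms are all equal, so the sum is \<open>p\<close> times one of
  them and lies in \<open>J 1\<close>, which gains one level.\<close>

lemma power_p_diff_in_J:
  assumes "x - y \<in> J i" "i \<ge> 1"
  shows "x ^ p - y ^ p \<in> J (Suc i)"
proof -
  have "x - y \<in> J 1" using assms J_antimono[of 1 i] by blast
  then have xy: "\<pi> x = \<pi> y" by (simp add: J_1_iff \<pi>_diff del: One_nat_def)
  have "\<pi> (\<Sum>j<p. y ^ (p - Suc j) * x ^ j) = (\<Sum>j<p. \<pi> y ^ (p - 1))"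
    unfolding \<pi>_sum by (intro sum.cong) (auto simp: \<pi>_mult \<pi>_power xy simp flip: power_add)
  also have "\<dots> = 0" by (simp add: p_def)
  finally have "(\<Sum>j<p. y ^ (p - Suc j) * x ^ j) \<in> J 1" by (simp add: J_1_iff del: One_nat_def)
  then show ?thesis using J_mult[OF assms(1), of _ 1] by (simp add: power_diff_sumr2)
qed

lemma power_p_power_diff_in_J:
  assumes "\<pi> x = \<pi> y"
  shows "x ^ (p ^ i) - y ^ (p ^ i) \<in> J (Suc i)"
proof (induction i)
  case 0
  then show ?case using assms J_1_iff[of "x - y"] by (simp add: \<pi>_diff)
next
  case (Suc i)
  then show ?case using power_p_diff_in_J[OF Suc]
    by (simp add: mult.commute[of p] power_mult)
qed

definition cong_J :: "'r \<Rightarrow> 'r \<Rightarrow> bool" where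
  "cong_J x y \<longleftrightarrow> x - y \<in> J k"

lemma cong_J_refl: "cong_J x x"
  by (simp add: cong_J_def zero_in_J)

lemma cong_J_sym: "cong_J x y \<Longrightarrow> cong_J y x"
  using J_uminus[of "x - y" k] by (simp add: cong_J_def)

lemma cong_J_trans [trans]: "cong_J x y \<Longrightarrow> cong_J y z \<Longrightarrow> cong_J x z"
  using J_add[of "x - y" k "y - z"] by (simp add: cong_J_def)

lemma cong_J_diff: "cong_J a b \<Longrightarrow> cong_J c d \<Longrightarrow> cong_J (a - c) (b - d)"
  using J_diff[of "a - b" k "c - d"] by (simp add: cong_J_def algebra_simps)

lemma cong_J_mult:
  assumes "cong_J a b" "cong_J c d"
  shows "cong_J (a * c) (b * d)"
proof -
  have "c * (a - b) + b * (c - d) \<in> J k"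
    using assms by (intro J_add J_mult_left) (auto simp: cong_J_def)
  then show ?thesis by (simp add: cong_J_def algebra_simps)
qed

lemma cong_J_sum: "(\<And>x. x \<in> A \<Longrightarrow> cong_J (f x) (g x)) \<Longrightarrow> cong_J (sum f A) (sum g A)"
  unfolding cong_J_def sum_subtractf[symmetric] by (rule J_sum)

lemma cong_J_prod: "(\<And>x. x \<in> A \<Longrightarrow> cong_J (f x) (g x)) \<Longrightarrow> cong_J (prod f A) (prod g A)"
  by (induction A rule: infinite_finite_induct) (auto intro: cong_J_refl cong_J_mult)

lemma cong_J_power: "cong_J a b \<Longrightarrow> cong_J (a ^ i) (b ^ i)"
  by (induction i) (auto intro: cong_J_refl cong_J_mult)

lemma cong_J_power_q_power:
  assumes "\<pi> x = \<pi> y"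
  shows "cong_J (x ^ (q ^ k)) (y ^ (q ^ k))"
proof -
  have "k \<le> Suc (k * k)" by (cases k) auto
  then show ?thesis
    using power_p_power_diff_in_J[OF assms, of "k * k"] J_antimono[of k "Suc (k * k)"]
    by (auto simp: cong_J_def q_eq simp flip: power_mult)
qed

text \<open>Raising to this exponent gives, modulo \<open>J k\<close>, the indicator function of the
  condition \<open>\<pi> x \<noteq> 0\<close>: the factor \<open>q - 1\<close> makes such an
  \<open>x\<close> congruent to 1 modulo \<open>J 1\<close>, and the factor \<open>q ^ k\<close>
  deepens this congruence to \<open>J k\<close>.\<close>

definition unit_exp :: nat where
  "unit_exp = (q - 1) * q ^ k"

lemma cong_J_power_unit_exp: "cong_J (x ^ unit_exp) (if \<pi> x = 0 then 0 else 1)"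
proof (cases "\<pi> x = 0")
  case True
  \<comment> \<open>Here the power lies in \<open>J unit_exp\<close>, so it suffices that
    \<open>unit_exp\<close> is at least \<open>k\<close>.\<close>
  have "k < 2 ^ k" by simp
  also have "2 ^ k \<le> q ^ k" by (intro power_mono q_ge_2) auto
  also have "\<dots> \<le> unit_exp" using q_ge_2 by (simp add: unit_exp_def)
  finally have "k \<le> unit_exp" by simp
  moreover have "x ^ unit_exp \<in> J unit_exp" using True J_power[of x] J_1_iff[of x] by blast
  ultimately show ?thesis using True J_antimono by (auto simp: cong_J_def)
next
  case False
  then have "\<pi> (x ^ (q - 1)) = \<pi> 1"
    by (simp only: \<pi>_power finite_field_power_card_minus_1 \<pi>_1 q_def not_False_eq_True)
  from cong_J_power_q_power[OF this] show ?thesis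
    using False by (simp add: unit_exp_def power_mult)
qed

text \<open>The Teichmueller representative to finite precision: any two lifts of \<open>a\<close>
  have \<open>q ^ k\<close>-th powers that agree modulo \<open>J k\<close>. The choice of the lift
  is therefore immaterial there, and \<open>teich\<close> is multiplicative modulo
  \<open>J k\<close>.\<close>

definition teich :: "'a \<Rightarrow> 'r" where
  "teich a = (SOME x. \<pi> x = a) ^ (q ^ k)"

lemma \<pi>_teich: "\<pi> (teich a) = a"
  unfolding teich_def \<pi>_power
  using someI_ex[OF \<pi>_surj[of a]] by (simp add: q_def finite_field_power_card_power)

lemma cong_J_teich_mult: "cong_J (teich (a * b)) (teich a * teich b)"
  unfolding teich_def power_mult_distrib[symmetric]
  by (rule cong_J_power_q_power) (simp add: \<pi>_mult someI_ex[OF \<pi>_surj])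

text \<open>For \<open>e = 0\<close> the sum is \<open>q\<close>. Otherwise take
  \<open>b \<noteq> 0\<close> with \<open>b ^ e \<noteq> 1\<close>: substituting
  \<open>b * a\<close> for \<open>a\<close> shows that \<open>teich b ^ e - 1\<close> times the sum
  lies in \<open>J k\<close>, and this factor has nonzero image under \<open>\<pi>\<close>.\<close>

lemma sum_teich_power_in_J:
  assumes "e = 0 \<or> \<not> (q - 1) dvd e"
  shows "(\<Sum>a\<in>UNIV. teich a ^ e) \<in> J k"
proof (cases "e = 0")
  case True
  then show ?thesis using of_nat_p_power_in_J[of k] by (simp add: q_eq flip: q_def)
next
  case False
  then obtain b :: 'a where b: "b \<noteq> 0" "b ^ e \<noteq> 1"
    using assms q_def finite_field_exists_power_neq_1 by blast
  define S where "S = (\<Sum>a\<in>UNIV. teich a ^ e)"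
  define u where "u = teich b ^ e - 1"
  have "cong_J S (\<Sum>a\<in>UNIV. teich (b * a) ^ e)"
  proof -
    have "S = (\<Sum>a\<in>UNIV. teich (b * a) ^ e)"
      unfolding S_def
      by (rule sum.reindex_bij_witness[of _ "\<lambda>x. b * x" "\<lambda>x. x / b"]) (use b in auto)
    then show ?thesis by (simp add: cong_J_refl)
  qed
  also have "cong_J (\<Sum>a\<in>UNIV. teich (b * a) ^ e) (\<Sum>a\<in>UNIV. (teich b * teich a) ^ e)"
    by (intro cong_J_sum cong_J_power cong_J_teich_mult)
  also have "(\<Sum>a\<in>UNIV. (teich b * teich a) ^ e) = teich b ^ e * S"
    by (simp add: S_def sum_distrib_left power_mult_distrib)
  finally have "S - teich b ^ e * S \<in> J k" by (simp add: cong_J_def)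
  from J_uminus[OF this] have uS: "u * S \<in> J k" by (simp add: u_def algebra_simps)
  have "\<pi> u \<noteq> 0" using b by (simp add: u_def \<pi>_diff \<pi>_power \<pi>_teich \<pi>_1)
  \<comment> \<open>The power \<open>u ^ unit_exp\<close>, congruent to 1 and a multiple of
    \<open>u\<close>, takes the place of a division by \<open>u\<close>.\<close>
  then have "cong_J (u ^ unit_exp) 1" using cong_J_power_unit_exp[of u] by simp
  then have "cong_J (u ^ unit_exp * S) (1 * S)" by (intro cong_J_mult cong_J_refl)
  moreover have "unit_exp > 0" using q_ge_2 by (simp add: unit_exp_def)
  then have "u ^ unit_exp * S = u ^ (unit_exp - 1) * (u * S)"
    by (cases unit_exp) (auto simp: ac_simps)
  then have "u ^ unit_exp * S \<in> J k" using J_mult_left[OF uS] by simp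
  ultimately have "S \<in> J k"
    using J_diff[of "u ^ unit_exp * S" k "u ^ unit_exp * S - S"] by (simp add: cong_J_def)
  then show ?thesis by (simp add: S_def)
qed

end

section \<open>Construction of the filtered ring from integer polynomials\<close>

definition int_poly_eval :: "'a::comm_ring_1 \<Rightarrow> int poly \<Rightarrow> 'a" where
  "int_poly_eval g r = poly (map_poly of_int r) g"

lemma int_poly_eval_pCons [simp]: "int_poly_eval g (pCons c r) = of_int c + g * int_poly_eval g r"
  by (simp add: int_poly_eval_def map_poly_pCons)

lemma int_poly_eval_0 [simp]: "int_poly_eval g 0 = 0"
  by (simp add: int_poly_eval_def)

lemma int_poly_eval_1 [simp]: "int_poly_eval g 1 = 1"
  by (simp add: one_pCons)

lemma int_poly_eval_add: "int_poly_eval g (r + s) = int_poly_eval g r + int_poly_eval g s"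
  by (induction r s rule: poly_induct2) (simp_all add: algebra_simps)

lemma int_poly_eval_smult: "int_poly_eval g (Polynomial.smult c r) = of_int c * int_poly_eval g r"
  by (induction r) (simp_all add: algebra_simps)

lemma int_poly_eval_mult: "int_poly_eval g (r * s) = int_poly_eval g r * int_poly_eval g s"
  by (induction r) (simp_all add: int_poly_eval_add int_poly_eval_smult algebra_simps)

lemma int_poly_eval_diff: "int_poly_eval g (r - s) = int_poly_eval g r - int_poly_eval g s"
  using int_poly_eval_add[of g "r - s" s] by simp

lemma int_poly_eval_monom: "int_poly_eval g (Polynomial.monom c i) = of_int c * g ^ i"
  by (induction i) (simp_all add: monom_Suc monom_0 algebra_simps)

lemma int_poly_eval_const_mult: "int_poly_eval g ([:c:] * r) = of_int c * int_poly_eval g r"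
  by (simp add: int_poly_eval_smult)

text \<open>The ring is \<open>\<int>[X]/(h)\<close> with \<open>h\<close> a lift of the minimal polynomial of a generator of the
  multiplicative group; the quotient is avoided by adding the multiples of \<open>h\<close> to each \<open>p\<^sup>i\<int>[X]\<close>.\<close>

lemma unramified_filtration_exists:
  "\<exists>(\<pi> :: int poly \<Rightarrow> 'a::{field,finite}) J k. unramified_filtration \<pi> J CHAR('a) CARD('a) k"
proof -
  define p where "p = CHAR('a)"
  have p: "prime p" unfolding p_def by (rule prime_CHAR_semidom) (simp add: finite_imp_CHAR_pos)
  obtain k where k: "k \<ge> 1" "CARD('a) = p ^ k"
    unfolding p_def using finite_field_card_prime_power by blast
  obtain g :: 'a where g: "\<And>x. x \<noteq> 0 \<Longrightarrow> \<exists>i::nat. x = g ^ i"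
    using finite_field_generator by blast
  define \<pi> where "\<pi> = int_poly_eval g"
  define M where "M = {r. lead_coeff r = 1 \<and> \<pi> r = 0}"
  have pz: "of_int (int p) = (0::'a)" by (simp add: p_def)
  \<comment> \<open>The polynomial \<open>X^q - X\<close>, with \<open>q = CARD('a)\<close>, shows
    that \<open>M\<close> is not empty.\<close>
  have "\<pi> (Polynomial.monom 1 CARD('a) - Polynomial.monom 1 1) = 0"
    by (simp add: \<pi>_def int_poly_eval_diff int_poly_eval_monom finite_field_power_card del: One_nat_def)
  moreover have "lead_coeff (Polynomial.monom 1 CARD('a) - Polynomial.monom 1 1 :: int poly) = 1"
  proof -
    have "Polynomial.degree (Polynomial.monom 1 1 :: int poly) < Polynomial.degree (Polynomial.monom 1 CARD('a) :: int poly)"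
      using finite_field_card_ge_2[where 'a='a] by (simp add: degree_monom_eq)
    then show ?thesis
      by (metis (no_types, lifting) diff_conv_add_uminus add.commute degree_minus lead_coeff_add_le lead_coeff_monom)
  qed
  ultimately have "Polynomial.monom 1 CARD('a) - Polynomial.monom 1 1 \<in> M" by (simp add: M_def)
  then obtain h where h: "h \<in> M" "\<And>r. r \<in> M \<Longrightarrow> Polynomial.degree h \<le> Polynomial.degree r"
    using ex_has_least_nat[of "\<lambda>r. r \<in> M" _ Polynomial.degree] by blast
  have lh: "lead_coeff h = 1" and \<pi>h: "\<pi> h = 0" using h by (auto simp: M_def)
  have h0: "h \<noteq> 0" using lh by auto
  have dh: "Polynomial.degree h > 0"
  proof (rule ccontr)
    assume "\<not> ?thesis"
    then obtain c where "h = [:c:]" by (metis degree_eq_zeroE not_gr_zero)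
    then show False using lh \<pi>h by (simp add: \<pi>_def)
  qed
  define J where "J i = {r. \<exists>a b. r = [:int p ^ i:] * a + h * b}" for i
  have JI: "r \<in> J i" if "r = [:int p ^ i:] * a + h * b" for r i a b
    using that unfolding J_def by blast
  \<comment> \<open>The leading coefficient of \<open>r\<close> is divisible by \<open>p\<close>,
    since otherwise \<open>r\<close> could be changed into an element of \<open>M\<close> of smaller
    degree than \<open>h\<close>. Removing the leading term then allows induction on the
    degree.\<close>
  have small: "\<exists>a. r = [:int p:] * a" if "\<pi> r = 0" "Polynomial.degree r < Polynomial.degree h" for r
    using that
  proof (induction "Polynomial.degree r" arbitrary: r rule: less_induct)
    case less
    define c where "c = lead_coeff r"
    have pc: "int p dvd c"
    proof (rule ccontr)
      assume n: "\<not> int p dvd c"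
      then have "coprime (int p) c" using p by (simp add: prime_imp_coprime)
      then obtain u where u: "[c * u = 1] (mod int p)"
        using cong_solve_coprime_int[of c "int p"] by (auto simp: coprime_commute)
      then obtain w where w: "1 = c * u + int p * w"
        by (metis cong_iff_lin mult.commute)
      \<comment> \<open>\<open>u\<close> inverts the leading coefficient modulo \<open>p\<close>;
        the added multiple of \<open>p\<close> corrects it to exactly 1 and is killed by
        \<open>\<pi>\<close>.\<close>
      define s where "s = [:u:] * r + Polynomial.monom (int p * w) (Polynomial.degree r)"
      have "coeff s (Polynomial.degree r) = 1" using w by (simp add: s_def c_def mult.commute)
      moreover have ds: "Polynomial.degree s \<le> Polynomial.degree r"
        unfolding s_def by (intro degree_add_le) (auto simp: degree_monom_le intro: order_trans[OF degree_smult_le])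
      ultimately have "Polynomial.degree s = Polynomial.degree r" by (metis le_degree one_neq_zero le_antisym)
      then have "lead_coeff s = 1" using \<open>coeff s _ = 1\<close> by simp
      moreover have "\<pi> s = 0"
        using less.prems pz
        by (simp add: s_def \<pi>_def int_poly_eval_add int_poly_eval_const_mult int_poly_eval_monom
            int_poly_eval_smult)
      ultimately have "s \<in> M" by (simp add: M_def)
      then show False using h(2)[of s] less.prems ds by simp
    qed
    then obtain c' where c': "c = int p * c'" by blast
    show ?case
    proof (cases "Polynomial.degree r = 0")
      case True
      then have "r = [:int p:] * [:c':]"
        using c' by (metis (no_types, lifting) c_def degree_eq_zeroE lead_coeff_pCons(2) mult_pCons_left smult_pCons smult_0_right mult_zero_left add.right_neutral pCons_0_0)
      then show ?thesis by blast
    next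
      case False
      define s where "s = r - Polynomial.monom c (Polynomial.degree r)"
      have "Polynomial.degree s < Polynomial.degree r"
      proof (rule degree_lessI)
        show "s \<noteq> 0 \<or> Polynomial.degree r > 0" using False by simp
        show "\<forall>j\<ge>Polynomial.degree r. Polynomial.coeff s j = 0"
          by (auto simp: s_def c_def coeff_eq_0)
      qed
      moreover have "\<pi> s = 0"
        using less.prems pz by (simp add: s_def \<pi>_def int_poly_eval_diff int_poly_eval_monom c')
      ultimately obtain a where "s = [:int p:] * a" using less.hyps[of s] less.prems by auto
      then have "r = [:int p:] * (a + Polynomial.monom c' (Polynomial.degree r))"
        by (simp add: s_def c' smult_add_right smult_monom algebra_simps)
      then show ?thesis by blast
    qed
  qed
  \<comment> \<open>As \<open>h\<close> is monic, pseudo-division introduces no scaling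
    factor.\<close>
  have division: "\<exists>s t. r = h * s + t \<and> (t = 0 \<or> Polynomial.degree t < Polynomial.degree h)" for r
    using pseudo_divmod[OF h0, of r "fst (pseudo_divmod r h)" "snd (pseudo_divmod r h)"] lh
    by auto
  have "unramified_filtration \<pi> J p CARD('a) k"
  proof
    show "p = CHAR('a)" "CARD('a) = CARD('a)" "CARD('a) = p ^ k" "1 \<le> k"
      using k by (auto simp: p_def)
    show "\<pi> (x + y) = \<pi> x + \<pi> y" "\<pi> (x * y) = \<pi> x * \<pi> y" "\<pi> 1 = 1" for x y
      by (simp_all add: \<pi>_def int_poly_eval_add int_poly_eval_mult)
    show "\<exists>x. \<pi> x = a" for a
    proof (cases "a = 0")
      case True
      then show ?thesis by (intro exI[of _ 0]) (simp add: \<pi>_def)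
    next
      case False
      then obtain i where "a = g ^ i" using g by blast
      then show ?thesis by (intro exI[of _ "Polynomial.monom 1 i"]) (simp add: \<pi>_def int_poly_eval_monom)
    qed
    show "J 0 = UNIV" using JI[of _ 0 _ 0] by (auto simp: one_pCons[symmetric])
    show "x \<in> J 1 \<longleftrightarrow> \<pi> x = 0" for x
    proof
      assume "x \<in> J 1"
      then obtain a b where "x = [:int p ^ 1:] * a + h * b" unfolding J_def by blast
      then show "\<pi> x = 0" using \<pi>h pz
        by (simp add: \<pi>_def int_poly_eval_add int_poly_eval_smult int_poly_eval_mult)
    next
      assume x: "\<pi> x = 0"
      obtain s t where st: "x = h * s + t" "t = 0 \<or> Polynomial.degree t < Polynomial.degree h"
        using division by blast
      have "\<pi> t = 0" using x \<pi>h by (simp add: st \<pi>_def int_poly_eval_add int_poly_eval_mult)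
      then obtain a where "t = [:int p:] * a"
        using st(2) small[of t] by (metis mult_zero_right)
      then show "x \<in> J 1" using st by (intro JI[of _ 1 a s]) simp
    qed
    show "x + y \<in> J i" if "x \<in> J i" "y \<in> J i" for x y i
    proof -
      obtain a b a' b' where "x = [:int p ^ i:] * a + h * b" "y = [:int p ^ i:] * a' + h * b'"
        using \<open>x \<in> J i\<close> \<open>y \<in> J i\<close> unfolding J_def by blast
      then show ?thesis by (intro JI[of _ _ "a + a'" "b + b'"]) (simp add: distrib_left smult_add_right)
    qed
    show "x * y \<in> J (i + j)" if "x \<in> J i" "y \<in> J j" for x y i j
    proof -
      obtain a b a' b' where xy: "x = [:int p ^ i:] * a + h * b" "y = [:int p ^ j:] * a' + h * b'"
        using \<open>x \<in> J i\<close> \<open>y \<in> J j\<close> unfolding J_def by blast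
      have pij: "[:int p ^ (i + j):] = [:int p ^ i:] * [:int p ^ j:]" by (simp add: power_add)
      show ?thesis unfolding xy
        by (rule JI[of _ _ "a * a'" "b * ([:int p ^ j:] * a' + h * b') + [:int p ^ i:] * a * b'"])
          (unfold pij, simp only: algebra_simps)
    qed
    show "J (Suc i) \<subseteq> J i" for i
    proof
      fix x assume "x \<in> J (Suc i)"
      then obtain a b where x: "x = [:int p ^ Suc i:] * a + h * b" unfolding J_def by blast
      show "x \<in> J i" by (rule JI[of _ _ "[:int p:] * a" b]) (simp add: x mult.commute)
    qed
    show "0 \<in> J i" for i by (rule JI[of _ _ 0 0]) simp
    show "int (p ^ i) dvd c" if c: "of_int c \<in> J i" for c i
    proof -
      obtain a b where ab: "of_int c = [:int p ^ i:] * a + h * b" using c unfolding J_def by blast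
      obtain s t where st: "a = h * s + t" "t = 0 \<or> Polynomial.degree t < Polynomial.degree h"
        using division by blast
      \<comment> \<open>After reduction of \<open>a\<close> to its remainder \<open>t\<close>, the
        left side has smaller degree than \<open>h\<close>. Being a multiple of \<open>h\<close> it
        vanishes, and constant coefficients can be compared.\<close>
      have e: "of_int c - [:int p ^ i:] * t = h * ([:int p ^ i:] * s + b)"
        using ab st(1) by (simp add: algebra_simps smult_add_right)
      have "Polynomial.degree (of_int c - [:int p ^ i:] * t) < Polynomial.degree h"
      proof (rule degree_diff_less)
        show "Polynomial.degree (of_int c :: int poly) < Polynomial.degree h" using dh by simp
        show "Polynomial.degree ([:int p ^ i:] * t) < Polynomial.degree h"
          using st(2) dh by (auto intro: le_less_trans[OF degree_smult_le])
      qed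
      then have "[:int p ^ i:] * s + b = 0"
        unfolding e using h0 by (metis degree_mult_eq not_add_less1)
      then have "of_int c = [:int p ^ i:] * t" using e by simp
      then have "coeff (of_int c) 0 = coeff ([:int p ^ i:] * t) 0" by simp
      then have "c = int p ^ i * coeff t 0" by (simp add: of_int_poly)
      then show ?thesis by simp
    qed
  qed
  then show ?thesis unfolding p_def by blast
qed

subsection \<open>Polynomial functions and the degree argument\<close>

text \<open>Functions are used in place of formal polynomials, and \<open>D\<close> only bounds the
  total degree of some representation. Closure under sums and products is then available by rule
  induction, and with it the passage to other linear coordinates.\<close>

inductive polyfun :: "nat \<Rightarrow> (('n::finite \<Rightarrow> 'a::comm_ring_1) \<Rightarrow> 'a) \<Rightarrow> bool" where
  polyfun_term: "(\<Sum>i\<in>UNIV. e i) \<le> D \<Longrightarrow> polyfun D (\<lambda>x. c * (\<Prod>i\<in>UNIV. x i ^ e i))"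
| polyfun_add: "polyfun D u \<Longrightarrow> polyfun D v \<Longrightarrow> polyfun D (\<lambda>x. u x + v x)"

lemma polyfun_mono: "polyfun D u \<Longrightarrow> D \<le> E \<Longrightarrow> polyfun E u"
  by (induction rule: polyfun.induct) (auto intro: polyfun.intros)

lemma polyfun_const: "polyfun D (\<lambda>x. c)"
  using polyfun_term[of "\<lambda>_. 0" D c] by simp

lemma polyfun_var: "D \<ge> 1 \<Longrightarrow> polyfun D (\<lambda>x. x i)"
  using polyfun_term[of "\<lambda>j. if j = i then 1 else 0" D 1] by (simp add: if_distrib cong: if_cong)

lemma polyfun_sum:
  "(\<And>j. j \<in> A \<Longrightarrow> polyfun D (u j)) \<Longrightarrow> polyfun D (\<lambda>x. \<Sum>j\<in>A. u j x)"
  by (induction A rule: infinite_finite_induct) (auto intro: polyfun_const polyfun_add)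

lemma polyfun_term_mult:
  "polyfun E v \<Longrightarrow> (\<Sum>i\<in>UNIV. e i) \<le> D \<Longrightarrow> polyfun (D + E) (\<lambda>x. c * (\<Prod>i\<in>UNIV. x i ^ e i) * v x)"
proof (induction rule: polyfun.induct)
  case (polyfun_term e' E c')
  then have "(\<Sum>i\<in>UNIV. e i + e' i) \<le> D + E" by (simp add: sum.distrib)
  from polyfun.polyfun_term[OF this, of "c * c'"] show ?case
    by (simp add: power_add prod.distrib ac_simps)
next
  case (polyfun_add E u v)
  then show ?case using polyfun.polyfun_add[OF polyfun_add.IH(1,2)] by (simp add: distrib_left)
qed

lemma polyfun_mult: "polyfun D u \<Longrightarrow> polyfun E v \<Longrightarrow> polyfun (D + E) (\<lambda>x. u x * v x)"
proof (induction rule: polyfun.induct)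
  case (polyfun_term e D c)
  then show ?case using polyfun_term_mult by blast
next
  case (polyfun_add D u w)
  then show ?case using polyfun.polyfun_add[of "D + E"] by (simp add: distrib_right)
qed

lemma polyfun_prod:
  "(\<And>j. j \<in> A \<Longrightarrow> polyfun (D j) (u j)) \<Longrightarrow> polyfun (\<Sum>j\<in>A. D j) (\<lambda>x. \<Prod>j\<in>A. u j x)"
  by (induction A rule: infinite_finite_induct) (auto intro: polyfun_const polyfun_mult)

lemma polyfun_power: "polyfun D u \<Longrightarrow> polyfun (i * D) (\<lambda>x. u x ^ i)"
  using polyfun_prod[of "{..<i}" "\<lambda>_. D" "\<lambda>_. u"] by simp

lemma polyfun_diff: "polyfun D u \<Longrightarrow> polyfun D v \<Longrightarrow> polyfun D (\<lambda>x. u x - v x)"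
  using polyfun_add[of D u "\<lambda>x. - 1 * v x"] polyfun_mult[OF polyfun_const[of 0 "- 1"], of D v] by simp

text \<open>Makes the coefficients explicit, because each one will be lifted by
  \<open>teich\<close>. The index \<open>j\<close> merely enumerates terms; a monomial may occur
  more than once.\<close>

lemma polyfun_expansion:
  fixes u :: "('n::finite \<Rightarrow> 'a::comm_ring_1) \<Rightarrow> 'a"
  assumes "polyfun D u"
  obtains n :: nat and c :: "nat \<Rightarrow> 'a" and m :: "nat \<Rightarrow> 'n \<Rightarrow> nat"
  where "\<And>j. j < n \<Longrightarrow> (\<Sum>i\<in>UNIV. m j i) \<le> D"
    "u = (\<lambda>x. \<Sum>j<n. c j * (\<Prod>i\<in>UNIV. x i ^ m j i))"
proof -
  have "\<exists>ts :: ('a \<times> ('n \<Rightarrow> nat)) list. (\<forall>t\<in>set ts. (\<Sum>i\<in>UNIV. snd t i) \<le> D) \<and>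
          u = (\<lambda>x. \<Sum>t\<leftarrow>ts. fst t * (\<Prod>i\<in>UNIV. x i ^ snd t i))"
    using assms
  proof (induction rule: polyfun.induct)
    case (polyfun_term e D c)
    then show ?case by (intro exI[of _ "[(c, e)]"]) auto
  next
    case (polyfun_add D u v)
    then obtain ts ts' :: "('a \<times> ('n \<Rightarrow> nat)) list" where
      "\<forall>t\<in>set ts. (\<Sum>i\<in>UNIV. snd t i) \<le> D" "u = (\<lambda>x. \<Sum>t\<leftarrow>ts. fst t * (\<Prod>i\<in>UNIV. x i ^ snd t i))"
      "\<forall>t\<in>set ts'. (\<Sum>i\<in>UNIV. snd t i) \<le> D" "v = (\<lambda>x. \<Sum>t\<leftarrow>ts'. fst t * (\<Prod>i\<in>UNIV. x i ^ snd t i))"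
      by blast
    then show ?case by (intro exI[of _ "ts @ ts'"]) auto
  qed
  then obtain ts :: "('a \<times> ('n \<Rightarrow> nat)) list" where ts: "\<forall>t\<in>set ts. (\<Sum>i\<in>UNIV. snd t i) \<le> D"
    "u = (\<lambda>x. \<Sum>t\<leftarrow>ts. fst t * (\<Prod>i\<in>UNIV. x i ^ snd t i))" by blast
  show ?thesis
  proof (rule that[of "length ts" "\<lambda>j. snd (ts ! j)" "\<lambda>j. fst (ts ! j)"])
    show "u = (\<lambda>x. \<Sum>j<length ts. fst (ts ! j) * (\<Prod>i\<in>UNIV. x i ^ snd (ts ! j) i))"
      unfolding ts(2) by (simp add: sum_list_sum_nth atLeast0LessThan)
  qed (use ts(1) in auto)
qed

section \<open>Sums over boxes with some coordinates free\<close>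

definition coset_box :: "'n::finite set \<Rightarrow> ('n::finite \<Rightarrow> 'a) \<Rightarrow> ('n \<Rightarrow> 'a) set" where
  "coset_box X t = {x. \<forall>i. i \<notin> X \<longrightarrow> x i = t i}"

lemma sum_coset_box_prod:
  fixes F :: "'n::finite \<Rightarrow> 'a::finite \<Rightarrow> 'r::comm_ring_1"
  shows "(\<Sum>x\<in>coset_box X t. \<Prod>i\<in>UNIV. F i (x i)) = (\<Prod>i\<in>X. \<Sum>a\<in>UNIV. F i a) * (\<Prod>i\<in>-X. F i (t i))"
proof -
  define B where "B i = (if i \<in> X then UNIV else {t i})" for i
  have "coset_box X t = PiE UNIV B"
    by (auto simp: coset_box_def B_def PiE_def Pi_def split: if_splits)
  then have "(\<Sum>x\<in>coset_box X t. \<Prod>i\<in>UNIV. F i (x i)) = (\<Prod>i\<in>UNIV. \<Sum>a\<in>B i. F i a)"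
    by (simp add: prod_sum_PiE)
  also have "\<dots> = (\<Prod>i\<in>X \<union> -X. \<Sum>a\<in>B i. F i a)" by (simp add: Compl_partition)
  also have "\<dots> = (\<Prod>i\<in>X. \<Sum>a\<in>B i. F i a) * (\<Prod>i\<in>-X. \<Sum>a\<in>B i. F i a)"
    by (rule prod.union_disjoint) auto
  also have "(\<Prod>i\<in>X. \<Sum>a\<in>B i. F i a) = (\<Prod>i\<in>X. \<Sum>a\<in>UNIV. F i a)"
    by (intro prod.cong) (auto simp: B_def)
  also have "(\<Prod>i\<in>-X. \<Sum>a\<in>B i. F i a) = (\<Prod>i\<in>-X. F i (t i))"
    by (intro prod.cong) (auto simp: B_def)
  finally show ?thesis .
qed

lemma finite_field_sum_powers_eq_0:
  assumes "e < CARD('a::{field,finite}) - 1"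
  shows "(\<Sum>a\<in>(UNIV :: 'a set). a ^ e) = 0"
proof (cases "e = 0")
  case True
  then show ?thesis
    using CHAR_dvd_CARD[where 'a='a] by (simp add: of_nat_eq_0_iff_char_dvd)
next
  case False
  then have "\<not> (CARD('a) - 1) dvd e" using assms by (auto dest: dvd_imp_le)
  then obtain b :: 'a where b: "b \<noteq> 0" "b ^ e \<noteq> 1"
    using finite_field_exists_power_neq_1 by blast
  define S where "S = (\<Sum>a\<in>(UNIV :: 'a set). a ^ e)"
  have "S = (\<Sum>a\<in>UNIV. (b * a) ^ e)" unfolding S_def
    by (rule sum.reindex_bij_witness[of _ "\<lambda>x. b * x" "\<lambda>x. x / b"]) (use b in auto)
  also have "\<dots> = b ^ e * S" by (simp add: S_def power_mult_distrib sum_distrib_left)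
  finally have "(b ^ e - 1) * S = 0" by (simp add: algebra_simps)
  then show ?thesis using b by (simp add: S_def)
qed

text \<open>A monomial survives the summation only if every free coordinate has exponent at least
  \<open>CARD('a) - 1\<close>. This uses up \<open>card X * (CARD('a) - 1)\<close> of the degree and
  leaves at most 1 for the fixed coordinates.\<close>

lemma sum_coset_box_polyfun_affine:
  fixes u :: "('n::finite \<Rightarrow> 'a::{field,finite}) \<Rightarrow> 'a"
  assumes "polyfun D u" "D \<le> card X * (CARD('a) - 1) + 1"
  shows "\<exists>c0 c. \<forall>t. (\<Sum>x\<in>coset_box X t. u x) = c0 + (\<Sum>i\<in>-X. c i * t i)"
  using assms
proof (induction rule: polyfun.induct)
  case (polyfun_term e D c)
  have eq: "(\<Sum>x\<in>coset_box X t. c * (\<Prod>i\<in>UNIV. x i ^ e i))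
      = c * (\<Prod>i\<in>X. \<Sum>a\<in>UNIV. a ^ e i) * (\<Prod>i\<in>-X. t i ^ e i)" for t :: "'n \<Rightarrow> 'a"
    using sum_coset_box_prod[of "\<lambda>i a. a ^ e i" X t] by (simp add: mult.assoc flip: sum_distrib_left)
  show ?case
  proof (cases "\<exists>i\<in>X. e i < CARD('a) - 1")
    case True
    then obtain i where "i \<in> X" "(\<Sum>a\<in>(UNIV :: 'a set). a ^ e i) = 0"
      using finite_field_sum_powers_eq_0 by blast
    then have "(\<Prod>i\<in>X. \<Sum>a\<in>(UNIV :: 'a set). a ^ e i) = 0" by (auto intro: prod_zero)
    then show ?thesis unfolding eq by (intro exI[of _ 0] exI[of _ "\<lambda>_. 0"]) simp
  next
    case False
    then have "(\<Sum>i\<in>X. e i) \<ge> (\<Sum>i\<in>X. CARD('a) - 1)" by (intro sum_mono) (simp add: not_less)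
    moreover have "(\<Sum>i\<in>UNIV. e i) = (\<Sum>i\<in>X. e i) + (\<Sum>i\<in>-X. e i)"
      using sum.union_disjoint[of X "-X" e] by simp
    ultimately have le1: "(\<Sum>i\<in>-X. e i) \<le> 1" using polyfun_term by simp
    define C where "C = c * (\<Prod>i\<in>X. \<Sum>a\<in>(UNIV :: 'a set). a ^ e i)"
    show ?thesis
    proof (cases "\<forall>i\<in>-X. e i = 0")
      case True
      then show ?thesis unfolding eq by (intro exI[of _ C] exI[of _ "\<lambda>_. 0"]) (simp add: C_def)
    next
      case False
      then obtain i where i: "i \<in> -X" "e i \<noteq> 0" by blast
      have s: "(\<Sum>j\<in>-X. e j) = e i + (\<Sum>j\<in>-X - {i}. e j)" using i by (simp add: sum.remove)
      have "e i = 1" using s le1 i by linarith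
      have "\<forall>j\<in>-X - {i}. e j = 0" using s le1 \<open>e i = 1\<close> by simp
      then have "(\<Prod>j\<in>-X. t j ^ e j) = t i" for t :: "'n \<Rightarrow> 'a"
        using i \<open>e i = 1\<close> by (subst prod.remove[of _ i]) auto
      then show ?thesis unfolding eq
        using i by (intro exI[of _ 0] exI[of _ "\<lambda>j. if j = i then C else 0"])
          (simp add: C_def if_distrib[of "\<lambda>x. x * _"] cong: if_cong)
    qed
  qed
next
  case (polyfun_add D u v)
  then obtain c0 c c0' c' where
    "\<forall>t. (\<Sum>x\<in>coset_box X t. u x) = c0 + (\<Sum>i\<in>-X. c i * t i)"
    "\<forall>t. (\<Sum>x\<in>coset_box X t. v x) = c0' + (\<Sum>i\<in>-X. c' i * t i)"
    by blast
  then show ?case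
    by (intro exI[of _ "c0 + c0'"] exI[of _ "\<lambda>i. c i + c' i"])
      (simp add: sum.distrib distrib_right)
qed

subsection \<open>The congruence modulo q\<close>

context unramified_filtration
begin

text \<open>Ax's trick: apply all powers of Frobenius to a monomial \<open>x\<^sup>e\<close>. A factor \<open>p\<close> is gained for each
  power that makes the reduced degree exceed \<open>(q - 1) D\<close>; if all \<open>k\<close> of them do, the term vanishes
  modulo \<open>p\<^sup>k\<close>. Counting level by level is what makes the bound additive under products.\<close>

definition bad_levels :: "nat \<Rightarrow> ('n::finite \<Rightarrow> nat) \<Rightarrow> nat set" where
  "bad_levels D e = {h. h < k \<and> (\<Sum>i\<in>UNIV. reduced_exp q (p ^ h * e i)) > (q - 1) * D}"

lemma finite_bad_levels [simp]: "finite (bad_levels D e)"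
  by (simp add: bad_levels_def)

lemma bad_levels_add_subset:
  "bad_levels (D + E) (\<lambda>i. e i + e' i) \<subseteq> bad_levels D e \<union> bad_levels E e'"
proof
  fix h assume h: "h \<in> bad_levels (D + E) (\<lambda>i. e i + e' i)"
  have "(\<Sum>i\<in>UNIV. reduced_exp q (p ^ h * (e i + e' i)))
      \<le> (\<Sum>i\<in>UNIV. reduced_exp q (p ^ h * e i) + reduced_exp q (p ^ h * e' i))"
    unfolding distrib_left by (intro sum_mono reduced_exp_add_le q_ge_2)
  then show "h \<in> bad_levels D e \<union> bad_levels E e'"
    using h by (simp add: bad_levels_def sum.distrib distrib_left) linarith
qed

text \<open>Each term carries at least one factor \<open>p\<close> for every bad level of its
  exponents. Since a bad level of a product is bad for one of the factors, the class is closed under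
  products, with the bounds \<open>D\<close> adding up.\<close>

inductive admissible :: "nat \<Rightarrow> (('n::finite \<Rightarrow> 'a) \<Rightarrow> 'r) \<Rightarrow> bool" where
  admissible_term: "card (bad_levels D e) \<le> v \<Longrightarrow>
    admissible D (\<lambda>x. c * of_nat p ^ v * (\<Prod>i\<in>UNIV. teich (x i) ^ e i))"
| admissible_add: "admissible D G \<Longrightarrow> admissible D H \<Longrightarrow> admissible D (\<lambda>x. G x + H x)"

lemma admissible_const: "admissible D (\<lambda>x. c)"
  using admissible_term[of D "\<lambda>_. 0" 0 c] by (simp add: bad_levels_def)

lemma admissible_term_mult:
  "admissible E H \<Longrightarrow> card (bad_levels D e) \<le> v \<Longrightarrow>
    admissible (D + E) (\<lambda>x. c * of_nat p ^ v * (\<Prod>i\<in>UNIV. teich (x i) ^ e i) * H x)"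
proof (induction rule: admissible.induct)
  case (admissible_term E e' v' c')
  have "card (bad_levels (D + E) (\<lambda>i. e i + e' i)) \<le> card (bad_levels D e) + card (bad_levels E e')"
    using card_mono[OF _ bad_levels_add_subset, of D e E e'] card_Un_le[of "bad_levels D e" "bad_levels E e'"]
    by simp
  then have "card (bad_levels (D + E) (\<lambda>i. e i + e' i)) \<le> v + v'" using admissible_term by simp
  from admissible.admissible_term[OF this, of "c * c'"] show ?case
    by (simp add: power_add prod.distrib ac_simps)
next
  case (admissible_add E u v)
  then show ?case using admissible.admissible_add[OF admissible_add.IH(1,2)] by (simp add: distrib_left)
qed

lemma admissible_mult:
  "admissible D G \<Longrightarrow> admissible E H \<Longrightarrow> admissible (D + E) (\<lambda>x. G x * H x)"
proof (induction rule: admissible.induct)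
  case (admissible_term D e v c)
  then show ?case using admissible_term_mult by blast
next
  case (admissible_add D u w)
  then show ?case using admissible.admissible_add[of "D + E"] by (simp add: distrib_right)
qed

lemma admissible_prod:
  "(\<And>j. j \<in> A \<Longrightarrow> admissible (D j) (G j)) \<Longrightarrow> admissible (\<Sum>j\<in>A. D j) (\<lambda>x. \<Prod>j\<in>A. G j x)"
  by (induction A rule: infinite_finite_induct) (auto intro: admissible_const admissible_mult)

lemma admissible_one_minus: "admissible D G \<Longrightarrow> admissible D (\<lambda>x. 1 - G x)"
  using admissible_add[OF admissible_const[of D 1], of "\<lambda>x. - 1 * G x"]
    admissible_mult[OF admissible_const[of 0 "- 1"], of D G] by simp

text \<open>Let \<open>L h\<close> be the total reduced exponent of the numbers
  \<open>p ^ h * a j\<close>. It is a positive multiple of \<open>q - 1\<close>, and at a bad level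
  it exceeds \<open>q - 1\<close>, hence is at least \<open>2 * (q - 1)\<close>. On the other hand
  the sum of all \<open>L h\<close> is bounded by the digit sums of the \<open>a j\<close>, which
  Legendre's formula expresses by the multiplicity of \<open>p\<close> in \<open>c\<close>.\<close>

lemma card_bad_levels_le_multiplicity:
  fixes m :: "'j \<Rightarrow> 'n::finite \<Rightarrow> nat"
  assumes A: "finite A" and m: "\<And>j. j \<in> A \<Longrightarrow> (\<Sum>i\<in>UNIV. m j i) \<le> D"
    and a: "(\<Sum>j\<in>A. a j) = unit_exp" and c: "c * (\<Prod>j\<in>A. fact (a j)) = (fact unit_exp :: nat)"
  shows "card (bad_levels D (\<lambda>i. \<Sum>j\<in>A. a j * m j i)) \<le> multiplicity p c"
proof -
  define B where "B = bad_levels D (\<lambda>i. \<Sum>j\<in>A. a j * m j i)"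
  define L where "L h = (\<Sum>j\<in>A. reduced_exp q (p ^ h * a j))" for h
  have p2: "p \<ge> 2" using prime_p by (simp add: prime_ge_2_nat)
  have upos: "unit_exp > 0" using q_ge_2 by (simp add: unit_exp_def)
  have Ldvd: "(q - 1) dvd L h" for h
  proof -
    have "[L h = (\<Sum>j\<in>A. p ^ h * a j)] (mod (q - 1))"
      unfolding L_def by (intro cong_sum reduced_exp_cong)
    also have "(\<Sum>j\<in>A. p ^ h * a j) = p ^ h * unit_exp" by (simp add: a flip: sum_distrib_left)
    finally show ?thesis by (simp add: unit_exp_def cong_dvd_iff)
  qed
  have Lpos: "L h > 0" for h
  proof -
    obtain j where j: "j \<in> A" "a j > 0" using a upos by (metis bot_nat_0.not_eq_extremum sum.neutral)
    then have "reduced_exp q (p ^ h * a j) > 0" using p2 by (intro reduced_exp_pos) auto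
    then show ?thesis unfolding L_def using j A by (intro sum_pos2[of _ j]) auto
  qed
  have Lge: "L h \<ge> (q - 1) * 1" for h using dvd_imp_le[OF Ldvd Lpos] by simp
  have Lbad: "L h \<ge> (q - 1) * 2" if "h \<in> B" for h
  proof -
    have "(\<Sum>i\<in>UNIV. reduced_exp q (p ^ h * (\<Sum>j\<in>A. a j * m j i)))
        \<le> (\<Sum>i\<in>UNIV. \<Sum>j\<in>A. m j i * reduced_exp q (p ^ h * a j))"
    proof (intro sum_mono)
      fix i
      have "p ^ h * (\<Sum>j\<in>A. a j * m j i) = (\<Sum>j\<in>A. m j i * (p ^ h * a j))"
        by (simp add: sum_distrib_left ac_simps)
      also have "reduced_exp q \<dots> \<le> (\<Sum>j\<in>A. reduced_exp q (m j i * (p ^ h * a j)))"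
        by (rule reduced_exp_sum_le[OF q_ge_2 A])
      also have "\<dots> \<le> (\<Sum>j\<in>A. m j i * reduced_exp q (p ^ h * a j))"
        by (intro sum_mono reduced_exp_mult_le q_ge_2)
      finally show "reduced_exp q (p ^ h * (\<Sum>j\<in>A. a j * m j i)) \<le> (\<Sum>j\<in>A. m j i * reduced_exp q (p ^ h * a j))" .
    qed
    also have "\<dots> = (\<Sum>j\<in>A. (\<Sum>i\<in>UNIV. m j i) * reduced_exp q (p ^ h * a j))"
      by (subst sum.swap) (simp add: sum_distrib_right)
    also have "\<dots> \<le> (\<Sum>j\<in>A. D * reduced_exp q (p ^ h * a j))"
      by (intro sum_mono mult_right_mono m) auto
    also have "\<dots> = D * L h" by (simp add: L_def sum_distrib_left)
    finally have le: "(\<Sum>i\<in>UNIV. reduced_exp q (p ^ h * (\<Sum>j\<in>A. a j * m j i))) \<le> D * L h" .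
    have "(q - 1) * D < D * L h" using that less_le_trans[OF _ le]
      by (simp only: B_def bad_levels_def mem_Collect_eq)
    then have "q - 1 < L h" by (simp add: mult.commute)
    moreover obtain w where w: "L h = (q - 1) * w" using Ldvd by blast
    ultimately have "w \<ge> 2" by (cases w; cases "w - 1") auto
    then show ?thesis unfolding w by (intro mult_left_mono) auto
  qed
  have B: "B \<subseteq> {..<k}" by (auto simp: B_def bad_levels_def)
  \<comment> \<open>Every level contributes \<open>q - 1\<close>, and every bad level
    \<open>q - 1\<close> more.\<close>
  have "(q - 1) * (k + card B) = (\<Sum>h<k. (q - 1) * 1) + (\<Sum>h\<in>B. q - 1)" by (simp add: algebra_simps)
  also have "(\<Sum>h\<in>B. q - 1) = (\<Sum>h<k. if h \<in> B then q - 1 else 0)"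
    using B by (simp add: sum.If_cases Int_absorb1)
  also have "(\<Sum>h<k. (q - 1) * 1) + \<dots> \<le> (\<Sum>h<k. L h)"
    unfolding sum.distrib[symmetric] using Lge Lbad
    by (intro sum_mono) (simp add: mult_2_right)
  finally have "(p - 1) * ((q - 1) * (k + card B)) \<le> (p - 1) * (\<Sum>h<k. L h)" by (rule mult_left_mono) simp
  also have "\<dots> = (\<Sum>j\<in>A. (p - 1) * (\<Sum>h<k. reduced_exp q (p ^ h * a j)))"
    unfolding L_def by (subst sum.swap) (simp add: sum_distrib_left)
  also have "\<dots> \<le> (\<Sum>j\<in>A. (q - 1) * digit_sum p (a j))"
    by (intro sum_mono sum_reduced_exp_le_digit_sum p2 q_eq k_pos)
  also have "\<dots> = (q - 1) * ((p - 1) * multiplicity p c + digit_sum p unit_exp)"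
    by (simp only: multiplicity_multinomial[OF prime_p A a c] sum_distrib_left[symmetric])
  \<comment> \<open>In base \<open>p\<close>, the number \<open>unit_exp\<close> consists of
    \<open>k\<close> digits \<open>p - 1\<close> followed by zeros. Its digit sum cancels exactly
    the basic contribution of the \<open>k\<close> levels.\<close>
  also have "digit_sum p unit_exp = k * (p - 1)"
  proof -
    have "q ^ k = p ^ (k * k)" "q - 1 = p ^ k - 1" by (simp_all add: q_eq power_mult)
    then show ?thesis
      by (simp only: unit_exp_def digit_sum_mult_power[OF p2] digit_sum_power_minus_1[OF p2])
  qed
  finally have "(q - 1) * ((p - 1) * (k + card B)) \<le> (q - 1) * ((p - 1) * (multiplicity p c + k))"
    by (simp only: distrib_left ac_simps)
  then have "k + card B \<le> multiplicity p c + k" using q_ge_2 p2 by simp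
  then show ?thesis by (simp add: B_def)
qed

text \<open>In the multinomial expansion, the factors \<open>p\<close> contained in a coefficient
  are enough to pay for the bad levels of the corresponding monomial.\<close>

lemma admissible_power_unit_exp:
  fixes m :: "nat \<Rightarrow> 'n::finite \<Rightarrow> nat"
  assumes m: "\<And>j. j < n \<Longrightarrow> (\<Sum>i\<in>UNIV. m j i) \<le> D"
  shows "admissible D (\<lambda>x. (\<Sum>j<n. c j * (\<Prod>i\<in>UNIV. teich (x i) ^ m j i)) ^ unit_exp)"
proof (rule multinomial_expansion_induct[where P = "admissible D"])
  fix a :: "nat \<Rightarrow> nat" and b :: nat
  assume a: "(\<Sum>j<n. a j) = unit_exp" and b: "b * (\<Prod>j<n. fact (a j)) = fact unit_exp"
  let ?v = "multiplicity p b"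
  let ?e = "\<lambda>i. \<Sum>j<n. a j * m j i"
  have "card (bad_levels D ?e) \<le> ?v"
    using m a b by (intro card_bad_levels_le_multiplicity) auto
  \<comment> \<open>The exact power of \<open>p\<close> is split off from the multinomial
    coefficient \<open>b\<close>.\<close>
  from admissible_term[OF this, of "of_nat (b div p ^ ?v) * (\<Prod>j<n. c j ^ a j)"]
  have ad: "admissible D (\<lambda>x. of_nat (b div p ^ ?v) * (\<Prod>j<n. c j ^ a j) * of_nat p ^ ?v *
       (\<Prod>i\<in>UNIV. teich (x i) ^ ?e i))" .
  have "b = b div p ^ ?v * p ^ ?v" by (simp add: multiplicity_dvd)
  then have bb: "(of_nat b :: 'r) = of_nat (b div p ^ ?v) * of_nat p ^ ?v"
    by (metis of_nat_mult of_nat_power)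
  have "of_nat (b div p ^ ?v) * (\<Prod>j<n. c j ^ a j) * of_nat p ^ ?v * (\<Prod>i\<in>UNIV. teich (x i) ^ ?e i)
      = of_nat b * (\<Prod>j<n. (c j * (\<Prod>i\<in>UNIV. teich (x i) ^ m j i)) ^ a j)" for x :: "'n \<Rightarrow> 'a"
  proof -
    have "(\<Prod>i\<in>UNIV. teich (x i) ^ ?e i) = (\<Prod>i\<in>UNIV. \<Prod>j<n. (teich (x i) ^ m j i) ^ a j)"
      by (simp add: power_sum mult.commute flip: power_mult)
    also have "\<dots> = (\<Prod>j<n. (\<Prod>i\<in>UNIV. teich (x i) ^ m j i) ^ a j)"
      by (subst prod.swap) (simp add: prod_power_distrib)
    finally show ?thesis by (simp add: bb power_mult_distrib prod.distrib ac_simps)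
  qed
  then show "admissible D (\<lambda>x. of_nat b * (\<Prod>j<n. (c j * (\<Prod>i\<in>UNIV. teich (x i) ^ m j i)) ^ a j))"
    using ad by simp
qed (auto intro: admissible_const admissible_add)

text \<open>A term without coordinates outside \<open>X\<close> has the same sum over all boxes. For
  any other term the sum lies in \<open>J k\<close>: either a power sum over a free coordinate does,
  or all exponents in \<open>X\<close> are positive multiples of \<open>q - 1\<close>. In the latter
  case the outside coordinate pushes the reduced degree above \<open>(q - 1) * D\<close> at all
  \<open>k\<close> levels, and the term contains the factor \<open>p ^ k\<close>.\<close>

lemma sum_coset_box_admissible:
  assumes "admissible D G" "D \<le> card X"
  shows "cong_J (\<Sum>x\<in>coset_box X t. G x) (\<Sum>x\<in>coset_box X t'. G x)"
  using assms
proof (induction rule: admissible.induct)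
  case (admissible_term D e v c)
  have eq: "(\<Sum>x\<in>coset_box X t. c * of_nat p ^ v * (\<Prod>i\<in>UNIV. teich (x i) ^ e i))
      = c * of_nat p ^ v * ((\<Prod>i\<in>X. \<Sum>a\<in>UNIV. teich a ^ e i) * (\<Prod>i\<in>-X. teich (t i) ^ e i))" for t
    using sum_coset_box_prod[of "\<lambda>i a. teich a ^ e i" X t] by (simp flip: sum_distrib_left)
  show ?case
  proof (cases "\<forall>i\<in>-X. e i = 0")
    case True
    then show ?thesis unfolding eq by (simp add: cong_J_refl)
  next
    case False
    then obtain i0 where i0: "i0 \<notin> X" "e i0 > 0" by auto
    have "c * of_nat p ^ v * ((\<Prod>i\<in>X. \<Sum>a\<in>UNIV. teich a ^ e i) * y) \<in> J k" for y
    proof (cases "\<exists>i\<in>X. e i = 0 \<or> \<not> (q - 1) dvd e i")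
      case True
      then obtain i where i: "i \<in> X" "e i = 0 \<or> \<not> (q - 1) dvd e i" by blast
      have "(\<Prod>i\<in>X. \<Sum>a\<in>UNIV. teich a ^ e i)
          = (\<Prod>i\<in>X - {i}. \<Sum>a\<in>UNIV. teich a ^ e i) * (\<Sum>a\<in>UNIV. teich a ^ e i)"
        using i by (subst prod.remove[of _ i]) (auto simp: mult.commute)
      then have "(\<Prod>i\<in>X. \<Sum>a\<in>UNIV. teich a ^ e i) \<in> J k"
        using sum_teich_power_in_J[OF i(2)] J_mult_left by simp
      then show ?thesis using J_mult_left by (metis mult.commute)
    next
      case False
      have "(q - 1) * D < (\<Sum>i\<in>UNIV. reduced_exp q (p ^ h * e i))" for h
      proof -
        have p0: "p > 0" using prime_p by (rule prime_gt_0_nat)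
        have "(q - 1) * D \<le> (\<Sum>i\<in>X. q - 1)" using admissible_term(2) by (simp add: mult.commute)
        also have "\<dots> = (\<Sum>i\<in>X. reduced_exp q (p ^ h * e i))"
          using False p0 by (intro sum.cong refl reduced_exp_of_multiple[symmetric] q_ge_2) auto
        also have "\<dots> < (\<Sum>i\<in>X. reduced_exp q (p ^ h * e i)) + reduced_exp q (p ^ h * e i0)"
          using i0 p0 by (simp add: reduced_exp_pos)
        also have "\<dots> = (\<Sum>i\<in>insert i0 X. reduced_exp q (p ^ h * e i))" using i0 by simp
        also have "\<dots> \<le> (\<Sum>i\<in>UNIV. reduced_exp q (p ^ h * e i))" by (intro sum_mono2) auto
        finally show ?thesis .
      qed
      then have "bad_levels D e = {..<k}" by (auto simp: bad_levels_def)
      then have "k \<le> v" using admissible_term(1) by simp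
      then have "of_nat p ^ v \<in> J k" using of_nat_p_power_in_J[of v] J_antimono by blast
      then show ?thesis using J_mult_left by (metis mult.commute)
    qed
    then show ?thesis unfolding eq cong_J_def by (intro J_diff)
  qed
next
  case (admissible_add D G H)
  have "cong_J ((\<Sum>x\<in>coset_box X t. G x) - (- (\<Sum>x\<in>coset_box X t. H x)))
     ((\<Sum>x\<in>coset_box X t'. G x) - (- (\<Sum>x\<in>coset_box X t'. H x)))"
    using admissible_add cong_J_mult[OF cong_J_refl[of "- 1"]] by (intro cong_J_diff) fastforce+
  then show ?case by (simp add: sum.distrib)
qed

end

text \<open>Modulo \<open>J k\<close> the product of the factors \<open>1 - U l x ^ unit_exp\<close>
  is the indicator function of the zero set, and it is admissible with a bound of at most
  \<open>card X\<close>. So its sums over boxes, which count zeros, are all congruent.\<close>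

theorem card_zeros_coset_box_cong:
  fixes u :: "nat \<Rightarrow> ('n::finite \<Rightarrow> 'a::{field,finite}) \<Rightarrow> 'a"
  assumes u: "\<And>l. l \<in> L \<Longrightarrow> polyfun (D l) (u l)" and L: "finite L" and X: "(\<Sum>l\<in>L. D l) \<le> card X"
  shows "[card {x \<in> coset_box X t. \<forall>l\<in>L. u l x = 0} = card {x \<in> coset_box X t'. \<forall>l\<in>L. u l x = 0}] (mod CARD('a))"
proof -
  obtain \<pi> :: "int poly \<Rightarrow> 'a" and J k where "unramified_filtration \<pi> J CHAR('a) CARD('a) k"
    using unramified_filtration_exists by blast
  then interpret unramified_filtration \<pi> J "CHAR('a)" "CARD('a)" k .
  define R where "R l n c m \<longleftrightarrow> (\<forall>j<n. (\<Sum>i\<in>UNIV. m j i) \<le> D l) \<and>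
      u l = (\<lambda>x. \<Sum>j<n. c j * (\<Prod>i\<in>UNIV. x i ^ m j i))"
    for l and n :: nat and c :: "nat \<Rightarrow> 'a" and m :: "nat \<Rightarrow> 'n \<Rightarrow> nat"
  have "\<exists>n c m. R l n c m" if l: "l \<in> L" for l
  proof -
    obtain n :: nat and c :: "nat \<Rightarrow> 'a" and m :: "nat \<Rightarrow> 'n \<Rightarrow> nat" where
      "\<And>j. j < n \<Longrightarrow> (\<Sum>i\<in>UNIV. m j i) \<le> D l" "u l = (\<lambda>x. \<Sum>j<n. c j * (\<Prod>i\<in>UNIV. x i ^ m j i))"
      by (rule polyfun_expansion[OF u[OF l]]) blast
    then have "R l n c m" unfolding R_def by blast
    then show ?thesis by blast
  qed
  then obtain n c m where R: "\<And>l. l \<in> L \<Longrightarrow> R l (n l) (c l) (m l)" by metis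
  then have m: "\<And>l j. l \<in> L \<Longrightarrow> j < n l \<Longrightarrow> (\<Sum>i\<in>UNIV. m l j i) \<le> D l"
    and ul: "\<And>l. l \<in> L \<Longrightarrow> u l = (\<lambda>x. \<Sum>j<n l. c l j * (\<Prod>i\<in>UNIV. x i ^ m l j i))"
    unfolding R_def by blast+
  define U where "U l x = (\<Sum>j<n l. teich (c l j) * (\<Prod>i\<in>UNIV. teich (x i) ^ m l j i))" for l and x :: "'n \<Rightarrow> 'a"
  have \<pi>U: "\<pi> (U l x) = u l x" if "l \<in> L" for l x
    by (simp add: U_def ul[OF that] \<pi>_sum \<pi>_mult \<pi>_prod \<pi>_power \<pi>_teich)
  define G where "G x = (\<Prod>l\<in>L. 1 - U l x ^ unit_exp)" for x
  have "admissible (\<Sum>l\<in>L. D l) G"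
    unfolding G_def U_def using m
    by (intro admissible_prod admissible_one_minus admissible_power_unit_exp) auto
  have card: "cong_J (of_nat (card {x \<in> coset_box X t. \<forall>l\<in>L. u l x = 0})) (\<Sum>x\<in>coset_box X t. G x)" for t
  proof -
    have "of_nat (card {x \<in> coset_box X t. \<forall>l\<in>L. u l x = 0})
        = (\<Sum>x\<in>coset_box X t. if \<forall>l\<in>L. u l x = 0 then 1 else 0 :: int poly)"
      by (simp add: sum.If_cases Collect_conj_eq Int_commute)
    also have "\<dots> = (\<Sum>x\<in>coset_box X t. \<Prod>l\<in>L. if u l x = 0 then 1 else 0)"
      using L by (intro sum.cong refl) (auto simp: prod_zero_iff)
    also have "cong_J \<dots> (\<Sum>x\<in>coset_box X t. G x)"
      unfolding G_def
    proof (intro cong_J_sum cong_J_prod)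
      fix x l assume "l \<in> L"
      then have "cong_J (1 - U l x ^ unit_exp) (1 - (if u l x = 0 then 0 else 1))"
        using cong_J_power_unit_exp[of "U l x"] by (intro cong_J_diff cong_J_refl) (simp add: \<pi>U)
      also have "1 - (if u l x = 0 then 0 else 1) = (if u l x = 0 then 1 else 0 :: int poly)" by simp
      finally show "cong_J (if u l x = 0 then 1 else 0) (1 - U l x ^ unit_exp)" by (rule cong_J_sym)
    qed
    finally show ?thesis .
  qed
  have "cong_J (of_nat (card {x \<in> coset_box X t. \<forall>l\<in>L. u l x = 0}))
     (of_nat (card {x \<in> coset_box X t'. \<forall>l\<in>L. u l x = 0}))"
    using card[of t] cong_J_sym[OF card[of t']] sum_coset_box_admissible[OF \<open>admissible _ G\<close> X, of t t']
      cong_J_trans by blast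
  then have "int (CHAR('a) ^ k) dvd
     int (card {x \<in> coset_box X t. \<forall>l\<in>L. u l x = 0}) - int (card {x \<in> coset_box X t'. \<forall>l\<in>L. u l x = 0})"
    by (intro J_int) (simp add: cong_J_def)
  then show ?thesis by (simp add: q_eq cong_iff_dvd_diff flip: cong_int_iff)
qed

subsection \<open>Cosets of subspaces\<close>

lemma card_coset_box:
  "card (coset_box X (t :: 'n::finite \<Rightarrow> 'a::finite)) = CARD('a) ^ card X"
proof -
  have "(of_nat (card (coset_box X t)) :: int) = (\<Sum>x\<in>coset_box X t. \<Prod>i\<in>(UNIV :: 'n set). 1)" by simp
  also have "\<dots> = int (CARD('a) ^ card X)"
    using sum_coset_box_prod[of "\<lambda>(_ :: 'n) (_ :: 'a). 1 :: int" X t] by simp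
  finally show ?thesis by simp
qed

definition coset :: "'a ^ 'n \<Rightarrow> ('a::field ^ 'n::finite) set \<Rightarrow> ('a ^ 'n) set" where
  "coset u W = {x. x - u \<in> W}"

section \<open>Coordinates adapted to a subspace\<close>

definition from_coords :: "('n::finite \<Rightarrow> 'a ^ 'n) \<Rightarrow> ('n \<Rightarrow> 'a) \<Rightarrow> 'a::field ^ 'n" where
  "from_coords b x = (\<Sum>i\<in>UNIV. x i *s b i)"

lemma from_coords_add: "from_coords b (\<lambda>i. x i + y i) = from_coords b x + from_coords b y"
  by (simp add: from_coords_def vec.scale_left_distrib sum.distrib)

lemma from_coords_scale: "from_coords b (\<lambda>i. c * x i) = c *s from_coords b x"
  by (simp add: from_coords_def vec.scale_sum_right)

lemma from_coords_diff: "from_coords b (\<lambda>i. x i - y i) = from_coords b x - from_coords b y"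
  using from_coords_add[of b "\<lambda>i. x i - y i" y] by simp

text \<open>A basis of \<open>W\<close> is extended to one of the whole space, with \<open>X\<close>
  indexing the part in \<open>W\<close>. Cosets of \<open>W\<close> become boxes, to which the
  results on polynomial functions apply.\<close>

lemma adapted_coordinates:
  fixes W :: "('a::{field,finite} ^ 'n::finite) set"
  assumes W: "vec.subspace W"
  obtains X b where "card X = vec.dim W" "bij (from_coords b)"
    "\<And>t. coset (from_coords b t) W = from_coords b ` coset_box X t"
proof -
  obtain B where B: "B \<subseteq> W" "vec.independent B" "W \<subseteq> vec.span B" "card B = vec.dim W"
    by (rule vec.basis_exists)
  have WB: "vec.span B = W"
    using B W vec.span_minimal by blast
  define E where "E = vec.extend_basis B"
  have E: "B \<subseteq> E" "vec.independent E" "vec.span E = UNIV"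
    unfolding E_def using vec.extend_basis_superset[OF B(2)] vec.independent_extend_basis[OF B(2)]
      vec.span_extend_basis[OF B(2)] by auto
  have "card E = vec.dim (UNIV :: ('a^'n) set)"
    using E by (intro vec.basis_card_eq_dim) auto
  then have "card E = CARD('n)" by (simp only: vec_dim_card)
  then obtain b where b: "bij_betw b (UNIV :: 'n set) E"
    using finite_same_card_bij[of "UNIV :: 'n set" E] by auto
  have injb: "inj b" and rb: "range b = E" using b by (auto simp: bij_betw_def)
  define X where "X = {i. b i \<in> B}"
  have bX: "b ` X = B" using E(1) rb by (auto simp: X_def)
  have cX: "card X = vec.dim W" using B(4) bX card_image[of b X] injb
    by (metis inj_on_subset subset_UNIV)
  have sp: "vec.span (b ` Y) = from_coords b ` coset_box Y (\<lambda>_. 0)" for Y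
  proof -
    have "vec.span (b ` Y) = range (\<lambda>u. \<Sum>v\<in>b ` Y. u v *s v)"
      by (rule vec.span_finite) simp
    also have "\<dots> = from_coords b ` coset_box Y (\<lambda>_. 0)"
    proof (intro equalityI subsetI)
      fix x assume "x \<in> range (\<lambda>u. \<Sum>v\<in>b ` Y. u v *s v)"
      then obtain u where "x = (\<Sum>v\<in>b ` Y. u v *s v)" by blast
      also have "\<dots> = (\<Sum>i\<in>Y. u (b i) *s b i)"
        using injb by (subst sum.reindex) (auto intro: inj_on_subset)
      also have "\<dots> = from_coords b (\<lambda>i. if i \<in> Y then u (b i) else 0)"
        unfolding from_coords_def by (intro sum.mono_neutral_cong_left) auto
      finally show "x \<in> from_coords b ` coset_box Y (\<lambda>_. 0)" by (auto simp: coset_box_def)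
    next
      fix x assume "x \<in> from_coords b ` coset_box Y (\<lambda>_. 0)"
      then obtain y where y: "\<And>i. i \<notin> Y \<Longrightarrow> y i = 0" "x = from_coords b y" by (auto simp: coset_box_def)
      have "x = (\<Sum>i\<in>Y. y i *s b i)"
        unfolding y(2) from_coords_def by (intro sum.mono_neutral_cong_right) (auto simp: y(1))
      also have "\<dots> = (\<Sum>v\<in>b ` Y. y (inv_into UNIV b v) *s v)"
        using injb by (subst sum.reindex) (auto intro: inj_on_subset)
      finally show "x \<in> range (\<lambda>u. \<Sum>v\<in>b ` Y. u v *s v)" by (intro image_eqI[of _ _ "\<lambda>v. y (inv_into UNIV b v)"]) auto
    qed
    finally show ?thesis .
  qed
  have surj: "surj (from_coords b)"
    using sp[of UNIV] E(3) rb by (auto simp: coset_box_def)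
  \<comment> \<open>Injectivity follows from surjectivity, domain and range being finite of equal
    size.\<close>
  have "card (range (from_coords b)) = CARD('a) ^ CARD('n)" by (simp add: surj)
  then have "inj (from_coords b)"
    by (intro eq_card_imp_inj_on) (auto simp: card_fun)
  then have bij: "bij (from_coords b)" using surj by (simp add: bij_def)
  have "coset (from_coords b t) W = from_coords b ` coset_box X t" for t
  proof (intro equalityI subsetI)
    fix x assume "x \<in> coset (from_coords b t) W"
    then obtain y where y: "x - from_coords b t = from_coords b y" "y \<in> coset_box X (\<lambda>_. 0)"
      using sp[of X] by (auto simp: coset_def bX WB)
    have "x = from_coords b (\<lambda>i. t i + y i)" using y by (simp add: from_coords_add diff_eq_eq)
    then show "x \<in> from_coords b ` coset_box X t" using y by (auto simp: coset_box_def)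
  next
    fix x assume "x \<in> from_coords b ` coset_box X t"
    then obtain y where y: "x = from_coords b y" "y \<in> coset_box X t" by blast
    have "x - from_coords b t = from_coords b (\<lambda>i. y i - t i)" by (simp add: y from_coords_diff)
    then show "x \<in> coset (from_coords b t) W" using y sp[of X] by (auto simp: coset_def bX WB coset_box_def)
  qed
  then show ?thesis using that[of X b] cX bij by blast
qed

lemma polyfun_from_coords: "polyfun 1 (\<lambda>x. from_coords b x $ j)"
  unfolding from_coords_def sum_component vector_smult_component
  by (intro polyfun_sum) (use polyfun_mult[OF polyfun_var[of 1] polyfun_const[of 0]] in simp)

lemma polyfun_mpoly_eval:
  fixes f :: "('n::finite, 'a::field) mpolynomial"
  shows "polyfun (total_degree f) (\<lambda>x. mpoly_eval f (from_coords b x))"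
  unfolding mpoly_eval_def
proof (rule polyfun_sum)
  fix m assume m: "m \<in> Poly_Mapping.keys f"
  have "monomial_degree m \<le> total_degree f"
    using m by (auto simp: total_degree_def)
  have "polyfun (\<Sum>i\<in>UNIV. Poly_Mapping.lookup m i * 1)
     (\<lambda>x. \<Prod>i\<in>UNIV. (from_coords b x $ i) ^ Poly_Mapping.lookup m i)"
    by (intro polyfun_prod polyfun_power polyfun_from_coords)
  then have "polyfun (total_degree f) (\<lambda>x. \<Prod>i\<in>UNIV. (from_coords b x $ i) ^ Poly_Mapping.lookup m i)"
    using \<open>monomial_degree m \<le> total_degree f\<close> by (auto intro: polyfun_mono simp: monomial_degree_def)
  from polyfun_mult[OF polyfun_const[of 0] this]
  show "polyfun (total_degree f) (\<lambda>x. Poly_Mapping.lookup f m *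
      (\<Prod>i\<in>UNIV. (from_coords b x $ i) ^ Poly_Mapping.lookup m i))" by simp
qed

lemma card_common_zeros_coset_cong:
  fixes f :: "nat \<Rightarrow> ('n::finite, 'a::{field,finite}) mpolynomial"
  assumes W: "vec.subspace W" and d: "(\<Sum>i=1..r. total_degree (f i)) \<le> vec.dim W"
  shows "[card (common_zeros r f \<inter> coset u W) = card (common_zeros r f \<inter> coset v W)] (mod CARD('a))"
proof -
  obtain X b where X: "card X = vec.dim W" and bij: "bij (from_coords b)"
    and cs: "\<And>t. coset (from_coords b t) W = from_coords b ` coset_box X t"
    using adapted_coordinates[OF W] by blast
  have inj: "inj (from_coords b)" using bij by (rule bij_is_inj)
  have eq: "card (common_zeros r f \<inter> coset (from_coords b t) W)
      = card {x \<in> coset_box X t. \<forall>l\<in>{1..r}. mpoly_eval (f l) (from_coords b x) = 0}" for t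
  proof -
    have "common_zeros r f \<inter> coset (from_coords b t) W
      = from_coords b ` {x \<in> coset_box X t. \<forall>l\<in>{1..r}. mpoly_eval (f l) (from_coords b x) = 0}"
      unfolding cs by (auto simp: common_zeros_def)
    then show ?thesis using inj by (simp add: card_image inj_on_def)
  qed
  obtain t s where "u = from_coords b t" "v = from_coords b s"
    using bij by (metis bij_pointE)
  show ?thesis
    unfolding \<open>u = _\<close> \<open>v = _\<close> eq
    using d X by (intro card_zeros_coset_box_cong[where D = "\<lambda>l. total_degree (f l)"] polyfun_mpoly_eval) simp_all
qed

text \<open>Each coordinate of the sum is a box sum of the indicator of the zero set, of degree at
  most \<open>CARD('a) - 1\<close> times the total of the degrees, multiplied by one linear form.
  The additional degree 1 is exactly what box sums tolerate while remaining affine.\<close>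

lemma sum_common_zeros_coset_affine:
  fixes f :: "nat \<Rightarrow> ('n::finite, 'a::{field,finite}) mpolynomial"
  assumes W: "vec.subspace W" and d: "(\<Sum>i=1..r. total_degree (f i)) \<le> vec.dim W"
  defines "\<phi> \<equiv> \<lambda>u. \<Sum>x\<in>common_zeros r f \<inter> coset u W. x"
  shows "\<phi> (u + v) + \<phi> 0 = \<phi> u + \<phi> v" "\<phi> (c *s u) - \<phi> 0 = c *s (\<phi> u - \<phi> 0)"
proof -
  obtain X b where X: "card X = vec.dim W" and bij: "bij (from_coords b)"
    and cs: "\<And>t. coset (from_coords b t) W = from_coords b ` coset_box X t"
    using adapted_coordinates[OF W] by blast
  have inj: "inj (from_coords b)" using bij by (rule bij_is_inj)
  have "\<exists>c0 c. \<forall>t. \<phi> (from_coords b t) $ j = c0 + (\<Sum>i\<in>-X. c i * t i)" for j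
  proof -
    define g where "g x = (\<Prod>l\<in>{1..r}. 1 - mpoly_eval (f l) (from_coords b x) ^ (CARD('a) - 1)) * (from_coords b x $ j)" for x
    have "polyfun ((\<Sum>l\<in>{1..r}. (CARD('a) - 1) * total_degree (f l)) + 1) g"
      unfolding g_def
      by (intro polyfun_mult polyfun_prod polyfun_diff polyfun_const polyfun_power polyfun_mpoly_eval polyfun_from_coords)
    moreover have "(\<Sum>l\<in>{1..r}. (CARD('a) - 1) * total_degree (f l)) + 1 \<le> card X * (CARD('a) - 1) + 1"
      using mult_right_mono[OF d, of "CARD('a) - 1"] X
      by (simp only: mult.commute[of "CARD('a) - 1"] sum_distrib_right add_le_cancel_right)
    ultimately obtain c0 c where c: "\<And>t. (\<Sum>x\<in>coset_box X t. g x) = c0 + (\<Sum>i\<in>-X. c i * t i)"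
      using sum_coset_box_polyfun_affine by blast
    have "\<phi> (from_coords b t) $ j = (\<Sum>x\<in>coset_box X t. g x)" for t
    proof -
      have "\<phi> (from_coords b t) $ j = (\<Sum>x\<in>coset (from_coords b t) W. if x \<in> common_zeros r f then x $ j else 0)"
        unfolding \<phi>_def by (simp add: sum_component sum.If_cases Int_commute)
      also have "\<dots> = (\<Sum>x\<in>coset_box X t. if from_coords b x \<in> common_zeros r f then from_coords b x $ j else 0)"
        unfolding cs using inj by (subst sum.reindex) (auto intro: inj_on_subset)
      also have "\<dots> = (\<Sum>x\<in>coset_box X t. g x)"
      proof (intro sum.cong refl)
        fix x
        have "(\<Prod>l\<in>{1..r}. 1 - mpoly_eval (f l) (from_coords b x) ^ (CARD('a) - 1))
            = (if from_coords b x \<in> common_zeros r f then 1 else 0)"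
        proof (cases "from_coords b x \<in> common_zeros r f")
          case True
          then show ?thesis using finite_field_card_ge_2[where 'a='a]
            by (auto simp: common_zeros_def power_0_left intro!: prod.neutral)
        next
          case False
          then obtain l where "l \<in> {1..r}" "mpoly_eval (f l) (from_coords b x) \<noteq> 0"
            by (auto simp: common_zeros_def)
          then show ?thesis using False
            by (auto intro!: prod_zero bexI[of _ l] simp: finite_field_power_card_minus_1 simp del: One_nat_def)
        qed
        then show "(if from_coords b x \<in> common_zeros r f then from_coords b x $ j else 0) = g x"
          by (simp add: g_def)
      qed
      finally show ?thesis .
    qed
    then show ?thesis using c by auto
  qed
  then obtain c0 cc where aff: "\<And>j t. \<phi> (from_coords b t) $ j = c0 j + (\<Sum>i\<in>-X. cc j i * t i)" by metis
  obtain t s where ts: "u = from_coords b t" "v = from_coords b s"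
    using bij by (metis bij_pointE)
  have "from_coords b (\<lambda>_. 0) = 0" by (simp add: from_coords_def)
  then have \<phi>0: "\<phi> 0 $ j = c0 j" for j using aff[of "\<lambda>_. 0" j] by simp
  have "u + v = from_coords b (\<lambda>i. t i + s i)" by (simp add: from_coords_add ts)
  then have "(\<phi> (u + v) + \<phi> 0) $ j = (\<phi> u + \<phi> v) $ j" for j
    using ts by (simp add: aff \<phi>0 distrib_left sum.distrib)
  then show "\<phi> (u + v) + \<phi> 0 = \<phi> u + \<phi> v" by (simp add: vec_eq_iff)
  have "c *s u = from_coords b (\<lambda>i. c * t i)" by (simp add: from_coords_scale ts)
  then have "(\<phi> (c *s u) - \<phi> 0) $ j = (c *s (\<phi> u - \<phi> 0)) $ j" for j
    using ts by (simp add: aff \<phi>0 sum_distrib_left ac_simps)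
  then show "\<phi> (c *s u) - \<phi> 0 = c *s (\<phi> u - \<phi> 0)" by (simp add: vec_eq_iff)
qed

section \<open>Cosets and their sizes\<close>

lemma coset_self: "vec.subspace W \<Longrightarrow> u \<in> coset u W"
  by (simp add: coset_def vec.subspace_0)

lemma coset_eq_iff: "vec.subspace W \<Longrightarrow> coset u W = coset v W \<longleftrightarrow> u - v \<in> W"
proof
  assume W: "vec.subspace W" and "coset u W = coset v W"
  then show "u - v \<in> W" using coset_self[OF W, of u] by (simp add: coset_def)
next
  assume W: "vec.subspace W" and uv: "u - v \<in> W"
  have "x - u \<in> W \<longleftrightarrow> x - v \<in> W" for x
  proof -
    have "x - v = (x - u) + (u - v)" "x - u = (x - v) - (u - v)" by simp_all
    then show ?thesis using vec.subspace_add[OF W] vec.subspace_diff[OF W] uv by metis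
  qed
  then show "coset u W = coset v W" by (simp add: coset_def)
qed

lemma card_coset:
  fixes W :: "('a::{field,finite} ^ 'n::finite) set"
  assumes "vec.subspace W"
  shows "card (coset u W) = CARD('a) ^ vec.dim W"
proof -
  obtain X b where X: "card X = vec.dim W" and bij: "bij (from_coords b)"
    and cs: "\<And>t. coset (from_coords b t) W = from_coords b ` coset_box X t"
    using adapted_coordinates[OF assms] by blast
  obtain t where "u = from_coords b t" using bij by (metis bij_pointE)
  then show ?thesis
    using bij_is_inj[OF bij] by (simp add: cs card_coset_box X card_image inj_on_subset[OF _ subset_UNIV])
qed

lemma card_subspace:
  fixes W :: "('a::{field,finite} ^ 'n::finite) set"
  assumes "vec.subspace W"
  shows "card W = CARD('a) ^ vec.dim W"
  using card_coset[OF assms, of 0] by (simp add: coset_def)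

section \<open>Adjoining a vector, and subspaces that avoid a cone\<close>

definition adjoin :: "'a ^ 'n \<Rightarrow> ('a::field ^ 'n::finite) set \<Rightarrow> ('a ^ 'n) set" where
  "adjoin w U = {x. \<exists>c. x - c *s w \<in> U}"

lemma adjoin_eq_span: "vec.subspace U \<Longrightarrow> adjoin w U = vec.span (insert w U)"
  by (simp add: adjoin_def vec.span_insert vec.span_eq_iff[THEN iffD2])

lemma subspace_adjoin: "vec.subspace U \<Longrightarrow> vec.subspace (adjoin w U)"
  by (simp add: adjoin_eq_span)

lemma dim_adjoin: "vec.subspace U \<Longrightarrow> w \<notin> U \<Longrightarrow> vec.dim (adjoin w U) = Suc (vec.dim U)"
  by (simp add: adjoin_eq_span vec.dim_insert vec.span_eq_iff[THEN iffD2])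

lemma adjoin_mem: "vec.subspace U \<Longrightarrow> w \<in> adjoin w U"
  by (simp add: adjoin_eq_span vec.span_base)

lemma card_adjoin_le:
  fixes U :: "('a::{field,finite} ^ 'n::finite) set"
  shows "card (adjoin w U) \<le> CARD('a) * card U"
proof -
  have "adjoin w U \<subseteq> (\<lambda>(c, u). c *s w + u) ` (UNIV \<times> U)"
  proof
    fix x assume "x \<in> adjoin w U"
    then obtain c where "x - c *s w \<in> U" by (auto simp: adjoin_def)
    then show "x \<in> (\<lambda>(c, u). c *s w + u) ` (UNIV \<times> U)"
      by (intro image_eqI[of _ _ "(c, x - c *s w)"]) auto
  qed
  then have "card (adjoin w U) \<le> card ((UNIV :: 'a set) \<times> U)"
    by (intro surj_card_le) auto
  then show ?thesis by (simp add: card_cartesian_product)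
qed

text \<open>Greedy extension by a vector \<open>w\<close> outside
  \<open>U + (S \<union> {0})\<close>. If the larger space met \<open>S\<close>, rescaling would put
  \<open>w\<close> into this set, as \<open>S\<close> is stable under nonzero scalars. The last
  extension starts from dimension \<open>K - 1\<close>, whence the exponent.\<close>

lemma subspace_avoiding_exists:
  fixes S :: "('a::{field,finite} ^ 'n::finite) set"
  assumes S: "\<And>c s. c \<noteq> 0 \<Longrightarrow> s \<in> S \<Longrightarrow> c *s s \<in> S" and S0: "0 \<notin> S"
    and card: "K > 0 \<Longrightarrow> CARD('a) ^ (K - 1) * (card S + 1) < CARD('a) ^ CARD('n)"
  shows "\<exists>W. vec.subspace W \<and> vec.dim W = K \<and> W \<inter> S = {}"
  using card
proof (induction K)
  case 0
  then show ?case using S0 by (intro exI[of _ "{0}"]) auto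
next
  case (Suc K)
  have less: "CARD('a) ^ K * (card S + 1) < CARD('a) ^ CARD('n)" using Suc.prems by simp
  have "\<exists>W. vec.subspace W \<and> vec.dim W = K \<and> W \<inter> S = {}"
  proof (rule Suc.IH)
    have "CARD('a) ^ (K - 1) * (card S + 1) \<le> CARD('a) ^ K * (card S + 1)"
      by (intro mult_right_mono power_increasing) auto
    then show "CARD('a) ^ (K - 1) * (card S + 1) < CARD('a) ^ CARD('n)" using less by linarith
  qed
  then obtain U where U: "vec.subspace U" "vec.dim U = K" "U \<inter> S = {}" by blast
  define bad where "bad = (\<lambda>(u, s). u + s) ` (U \<times> insert 0 S)"
  have "card bad \<le> card (U \<times> insert 0 S)" unfolding bad_def by (intro card_image_le) auto
  also have "\<dots> = CARD('a) ^ K * (card S + 1)"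
    using S0 U by (simp add: card_cartesian_product card_subspace)
  finally have "card bad < card (UNIV :: ('a ^ 'n) set)" using less by simp
  then obtain w where w: "w \<notin> bad" by (metis UNIV_I less_irrefl subsetI subset_UNIV subset_antisym)
  have nU: "w \<notin> U" using w by (force simp: bad_def)
  have "adjoin w U \<inter> S = {}"
  proof (rule ccontr)
    assume "\<not> ?thesis"
    then obtain x c where x: "x \<in> S" "x - c *s w \<in> U" by (auto simp: adjoin_def)
    show False
    proof (cases "c = 0")
      case True
      then show False using x U by auto
    next
      case False
      define y where "y = inverse c *s (- (x - c *s w))"
      have yU: "y \<in> U" unfolding y_def by (intro vec.subspace_scale vec.subspace_neg U x)
      have "w = y + inverse c *s x"
        using False by (simp add: y_def vec.scale_right_diff_distrib)
      moreover have "inverse c *s x \<in> S" using S x False by simp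
      ultimately show False using w yU by (force simp: bad_def)
    qed
  qed
  then show ?case using subspace_adjoin[OF U(1)] dim_adjoin[OF U(1) nU] U(2) by blast
qed

lemma cong_1_card_ge:
  assumes "[c = 1] (mod q)" "c \<noteq> 1" "q \<ge> (2::nat)"
  shows "c \<ge> q + 1"
proof -
  have "c \<noteq> 0" using assms(1,3) by (intro notI) (simp add: cong_def)
  then obtain c' where c: "c = Suc c'" by (cases c) auto
  have "[c' = 0] (mod q)" using assms(1) cong_add_rcancel_nat[of c' 1 0 q] c by simp
  then have "q dvd c'" by (simp add: cong_0_iff)
  moreover have "c' \<noteq> 0" using assms c by auto
  ultimately show ?thesis using dvd_imp_le[of q c'] c by simp
qed

lemma sum_indicator_eq_card: "finite S \<Longrightarrow> (\<Sum>x\<in>S. if P x then 1 else 0 :: nat) = card {x \<in> S. P x}"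
  by (simp add: sum.inter_filter[symmetric])

lemma coset_0 [simp]: "coset 0 W = W"
  by (simp add: coset_def)

text \<open>The directions \<open>v - y\<close> lie in \<open>adjoin (v - a) V0\<close>, which meets
  \<open>U\<close> only in 0. Two representations of \<open>x\<close> modulo \<open>U\<close>
  therefore agree exactly: comparing the multiples of \<open>v - a\<close> gives
  \<open>k1 = k2\<close>, which is nonzero because \<open>x\<close> is not in
  \<open>U\<close>.\<close>

lemma adjoin_disjoint:
  fixes U V0 :: "('a::field ^ 'n::finite) set"
  assumes U: "vec.subspace U" and V0: "vec.subspace V0"
    and v: "v - a \<notin> V0" and UH: "U \<inter> (adjoin (v - a) V0 - {0}) = {}"
    and y: "y1 - a \<in> V0" "y2 - a \<in> V0"
    and x: "x \<in> adjoin (v - y1) U" "x \<in> adjoin (v - y2) U" "x \<notin> U"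
  shows "y1 = y2"
proof -
  obtain k1 k2 where k: "x - k1 *s (v - y1) \<in> U" "x - k2 *s (v - y2) \<in> U"
    using x by (auto simp: adjoin_def)
  define \<delta> where "\<delta> = k1 *s (v - y1) - k2 *s (v - y2)"
  have "\<delta> = (x - k2 *s (v - y2)) - (x - k1 *s (v - y1))" by (simp add: \<delta>_def)
  then have \<delta>U: "\<delta> \<in> U" using vec.subspace_diff[OF U k(2) k(1)] by simp
  have "\<delta> - (k1 - k2) *s (v - a) = k2 *s (y2 - a) - k1 *s (y1 - a)"
    by (simp add: \<delta>_def vec.scale_left_diff_distrib vec.scale_right_diff_distrib)
  then have \<delta>V: "\<delta> - (k1 - k2) *s (v - a) \<in> V0"
    using vec.subspace_diff[OF V0] vec.subspace_scale[OF V0] y by simp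
  then have "\<delta> \<in> adjoin (v - a) V0" by (auto simp: adjoin_def)
  then have \<delta>0: "\<delta> = 0" using \<delta>U UH by blast
  have k12: "k1 = k2"
  proof (rule ccontr)
    assume n: "k1 \<noteq> k2"
    have "(k1 - k2) *s (v - a) \<in> V0" using \<delta>V \<delta>0 vec.subspace_neg[OF V0] by fastforce
    then have "inverse (k1 - k2) *s ((k1 - k2) *s (v - a)) \<in> V0" by (rule vec.subspace_scale[OF V0])
    then show False using n v by simp
  qed
  have "k1 \<noteq> 0" using k(1) x(3) by auto
  then have "v - y1 = v - y2" using \<delta>0 k12 by (simp add: \<delta>_def)
  then show ?thesis by simp
qed

subsection \<open>Counting\<close>

text \<open>Isolates what the counting uses about the zero set: the congruence of the numbers of
  points in the cosets of \<open>d\<close>-dimensional spaces, and the affine dependence of the sums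
  of these points. Here \<open>m\<close> is \<open>n - d\<close>.\<close>

locale chevalley_warning_set =
  fixes z :: "('a::{field,finite} ^ 'n::finite) set" and d m q Q N :: nat
  assumes q: "q = CARD('a)" and dm: "CARD('n) = d + m" and Q: "Q = q ^ m" and N: "N = card z"
    and m_pos: "m > 0"
    and card_cong: "vec.subspace W \<Longrightarrow> vec.dim W = d \<Longrightarrow>
      [card (z \<inter> coset u W) = card (z \<inter> coset v W)] (mod q)"
    and sum_add: "vec.subspace W \<Longrightarrow> vec.dim W = d \<Longrightarrow>
      \<Sum>(z \<inter> coset (u + v) W) + \<Sum>(z \<inter> coset 0 W) = \<Sum>(z \<inter> coset u W) + \<Sum>(z \<inter> coset v W)"
    and sum_scale: "vec.subspace W \<Longrightarrow> vec.dim W = d \<Longrightarrow>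
      \<Sum>(z \<inter> coset (c *s u) W) - \<Sum>(z \<inter> coset 0 W)
        = c *s (\<Sum>(z \<inter> coset u W) - \<Sum>(z \<inter> coset 0 W))"
    and nonempty: "z \<noteq> {}"
    and not_affine: "\<not> affine_linear_subspace z"
begin

lemma q_ge_2: "q \<ge> 2"
  unfolding q by (rule finite_field_card_ge_2)

lemma Q_ge_q: "Q \<ge> q"
  using m_pos q_ge_2 unfolding Q by (metis Suc_leI One_nat_def power_increasing power_one_right one_le_numeral order_trans)

lemma card_space: "CARD('a) ^ CARD('n) = q ^ d * Q"
  by (simp add: q dm Q power_add)

lemma N_pos: "N \<ge> 1"
  using nonempty by (simp add: N Suc_le_eq card_gt_0_iff)

text \<open>Double counting of the pairs \<open>(u, x)\<close> with \<open>x\<close> in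
  \<open>z\<close> and \<open>x - u\<close> in \<open>W\<close>.\<close>

lemma card_le_mult_of_coset_bound:
  assumes W: "vec.subspace W" "vec.dim W = d" and c: "\<And>u. card (z \<inter> coset u W) \<ge> c"
  shows "N \<ge> c * Q"
proof -
  have "(\<Sum>u\<in>UNIV. card (z \<inter> coset u W)) = (\<Sum>x\<in>z. card (coset x W))"
  proof -
    have "card (z \<inter> coset u W) = (\<Sum>x\<in>z. if x - u \<in> W then 1 else 0)" for u
      by (simp add: sum.If_cases coset_def)
    then have "(\<Sum>u\<in>UNIV. card (z \<inter> coset u W)) = (\<Sum>u\<in>UNIV. \<Sum>x\<in>z. if x - u \<in> W then 1 else 0)"
      by simp
    also have "\<dots> = (\<Sum>x\<in>z. \<Sum>u\<in>UNIV. if x - u \<in> W then 1 else 0)" by (rule sum.swap)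
    also have "\<dots> = (\<Sum>x\<in>z. card (coset x W))"
    proof (intro sum.cong refl)
      fix x
      have "{u. x - u \<in> W} = coset x W"
        unfolding coset_def using vec.subspace_neg[OF W(1)] by (metis (no_types) minus_diff_eq)
      then show "(\<Sum>u\<in>UNIV. if x - u \<in> W then 1 else 0) = card (coset x W)"
        by (simp add: sum.If_cases)
    qed
    finally show ?thesis .
  qed
  also have "\<dots> = N * q ^ d" by (simp add: card_coset[OF W(1)] W(2) N q)
  finally have "(\<Sum>u\<in>(UNIV :: ('a^'n) set). c) \<le> N * q ^ d" using c by (metis sum_mono)
  then have "q ^ d * (c * Q) \<le> q ^ d * N" using card_space by (simp add: ac_simps)
  then show ?thesis using q_ge_2 by simp
qed

text \<open>When every coset of \<open>W\<close> contains \<open>1\<close> modulo \<open>q\<close> points of \<open>z\<close>, the sums of these points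
  form a section of the quotient map which is an affine map, by the degree argument.\<close>

lemma affine_section:
  assumes W: "vec.subspace W" "vec.dim W = d"
    and one: "\<And>u. [card (z \<inter> coset u W) = 1] (mod q)"
  obtains a V0 where "vec.subspace V0" "card (coset a V0) = Q" "N \<ge> Q + q * card (coset a V0 - z)"
    "\<And>u x. z \<inter> coset u W = {x} \<Longrightarrow> x \<in> coset a V0" "z - coset a V0 \<noteq> {}"
proof -
  define \<phi> where "\<phi> u = \<Sum>(z \<inter> coset u W)" for u
  have \<phi>_cong: "\<phi> u = \<phi> v" if "u - v \<in> W" for u v
    using that coset_eq_iff[OF W(1), of u v] by (simp add: \<phi>_def)
  \<comment> \<open>The number of points in the coset is 1 in the field, so that many copies of
    \<open>u\<close> add up to \<open>u\<close>, and \<open>\<phi> u - u\<close> becomes a sum of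
    elements of \<open>W\<close>.\<close>
  have \<phi>_mem: "\<phi> u - u \<in> W" for u
  proof -
    have "CHAR('a) dvd q" unfolding q by (rule CHAR_dvd_CARD)
    then have "[card (z \<inter> coset u W) = 1] (mod CHAR('a))" using one cong_dvd_modulus_nat by blast
    then have "(of_nat (card (z \<inter> coset u W)) :: 'a) = of_nat 1" by (simp only: of_nat_eq_iff_cong_CHAR)
    then have "(\<Sum>x\<in>z \<inter> coset u W. u) $ i = u $ i" for i
      unfolding sum_component by simp
    then have "(\<Sum>x\<in>z \<inter> coset u W. u) = u" by (simp add: vec_eq_iff del: sum_constant)
    then have "\<phi> u - u = (\<Sum>x\<in>z \<inter> coset u W. x - u)" by (simp add: \<phi>_def sum_subtractf)
    also have "\<dots> \<in> W" by (rule vec.subspace_sum[OF W(1)]) (auto simp: coset_def)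
    finally show ?thesis .
  qed
  define a where "a = \<phi> 0"
  define V0 where "V0 = range (\<lambda>u. \<phi> u - a)"
  have add: "\<phi> (u + v) = \<phi> u + \<phi> v - a" for u v
    using sum_add[OF W, of u v] by (simp add: \<phi>_def a_def algebra_simps)
  have scale: "\<phi> (c *s u) = c *s (\<phi> u - a) + a" for c u
    using sum_scale[OF W, of c u] by (simp add: \<phi>_def a_def algebra_simps)
  have V0: "vec.subspace V0"
  proof (rule vec.subspaceI)
    show "0 \<in> V0" unfolding V0_def by (rule range_eqI[of _ _ 0]) (simp add: a_def)
    fix x y c assume "x \<in> V0" then obtain u where x: "x = \<phi> u - a" by (auto simp: V0_def)
    show "c *s x \<in> V0" unfolding V0_def x by (rule range_eqI[of _ _ "c *s u"]) (simp add: scale)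
    assume "y \<in> V0" then obtain v where y: "y = \<phi> v - a" by (auto simp: V0_def)
    show "x + y \<in> V0" unfolding V0_def x y by (rule range_eqI[of _ _ "u + v"]) (simp add: add)
  qed
  define V where "V = coset a V0"
  have V: "V = range \<phi>" by (auto simp: V_def coset_def V0_def image_iff)
  have \<phi>V: "\<phi> y = y" if "y \<in> V" for y
  proof -
    obtain u where "y = \<phi> u" using \<open>y \<in> V\<close> V by auto
    then show ?thesis using \<phi>_cong[OF \<phi>_mem[of u]] by simp
  qed
  \<comment> \<open>\<open>V\<close> is a transversal: each coset of \<open>W\<close> contains
    exactly one point of \<open>V\<close>.\<close>
  have part: "(\<Sum>y\<in>V. card (S \<inter> coset y W)) = card S" for S
  proof -
    have "S = (\<Union>y\<in>V. S \<inter> coset y W)"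
    proof -
      have "x \<in> coset (\<phi> x) W" for x
        using vec.subspace_neg[OF W(1) \<phi>_mem[of x]] by (simp add: coset_def)
      then show ?thesis using V by auto
    qed
    then have "card S = card (\<Union>y\<in>V. S \<inter> coset y W)" by simp
    also have "\<dots> = (\<Sum>y\<in>V. card (S \<inter> coset y W))"
    proof (rule card_UN_disjoint)
      show "\<forall>i\<in>V. \<forall>j\<in>V. i \<noteq> j \<longrightarrow> (S \<inter> coset i W) \<inter> (S \<inter> coset j W) = {}"
      proof (intro ballI impI)
        fix i j assume ij: "i \<in> V" "j \<in> V" "i \<noteq> j"
        show "(S \<inter> coset i W) \<inter> (S \<inter> coset j W) = {}"
        proof (rule ccontr)
          assume "\<not> ?thesis"
          then obtain x where "x - i \<in> W" "x - j \<in> W" by (auto simp: coset_def)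
          then have "\<phi> i = \<phi> j" using \<phi>_cong by metis
          then show False using ij \<phi>V by auto
        qed
      qed
    qed auto
    finally show ?thesis by simp
  qed
  have "card V * q ^ d = q ^ d * Q"
    using part[of UNIV] card_space by (simp add: card_coset[OF W(1)] W(2) q)
  then have cV: "card V = Q" using q_ge_2 by simp
  have single: "x \<in> V" if "z \<inter> coset u W = {x}" for u x
  proof -
    have "\<phi> u = x" by (simp add: \<phi>_def that)
    then show ?thesis using V by auto
  qed
  \<comment> \<open>If the coset of \<open>y\<close> has only one point of \<open>z\<close>, this
    point is \<open>\<phi> y = y\<close>; otherwise the congruence forces at least
    \<open>q + 1\<close> points.\<close>
  have ge: "card (z \<inter> coset y W) \<ge> 1 + (if y \<in> z then 0 else q)" if "y \<in> V" for y
  proof (cases "card (z \<inter> coset y W) = 1")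
    case True
    then obtain x where x: "z \<inter> coset y W = {x}" by (auto simp: card_1_singleton_iff)
    then have "\<phi> y = x" by (simp add: \<phi>_def)
    then have "y \<in> z" using \<phi>V[OF that] x by auto
    then show ?thesis using True by simp
  next
    case False
    then show ?thesis using cong_1_card_ge[OF one False q_ge_2] by simp
  qed
  have "(\<Sum>y\<in>V. if y \<in> z then 0 else q) = (\<Sum>y\<in>V - z. q)"
    by (intro sum.mono_neutral_cong_right) auto
  then have "Q + q * card (V - z) = (\<Sum>y\<in>V. 1) + (\<Sum>y\<in>V. if y \<in> z then 0 else q)"
    by (simp add: cV)
  also have "\<dots> = (\<Sum>y\<in>V. 1 + (if y \<in> z then 0 else q))" by (rule sum.distrib[symmetric])
  also have "\<dots> \<le> (\<Sum>y\<in>V. card (z \<inter> coset y W))" by (intro sum_mono ge)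
  also have "\<dots> = N" by (simp only: part N)
  finally have ineq: "Q + q * card (V - z) \<le> N" .
  \<comment> \<open>Otherwise \<open>z\<close> has at most \<open>Q\<close> points, the inequality
    leaves no point of \<open>V\<close> outside \<open>z\<close>, and \<open>z = V\<close> would be
    affine.\<close>
  have "z - V \<noteq> {}"
  proof
    assume "z - V = {}"
    then have zV: "z \<subseteq> V" by blast
    then have "N \<le> Q" using card_mono[of V z] cV N by simp
    then have "q * card (V - z) = 0" using ineq by linarith
    then have "z = V" using zV q_ge_2 by auto
    also have "V = (\<lambda>v. a + v) ` V0"
    proof (intro equalityI subsetI)
      fix x assume "x \<in> V"
      then show "x \<in> (\<lambda>v. a + v) ` V0" by (intro image_eqI[of _ _ "x - a"]) (auto simp: V_def coset_def)
    qed (auto simp: V_def coset_def)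
    finally show False using not_affine V0 by (auto simp: affine_linear_subspace_def)
  qed
  then show ?thesis using that[of V0 a] V0 cV ineq single by (simp add: V_def)
qed

section \<open>Cones of differences and the bound \<open>N > Q\<close>\<close>

text \<open>A linear subspace is disjoint from this set precisely when its translate through
  \<open>v\<close> meets \<open>z\<close> in no point other than \<open>v\<close>. Closing the
  differences under nonzero scalars makes the avoidance argument applicable.\<close>

definition diff_cone :: "'a ^ 'n \<Rightarrow> ('a ^ 'n) set" where
  "diff_cone v = (\<lambda>(c, x). c *s (x - v)) ` ((- {0}) \<times> (z - {v}))"

lemma diff_cone_scale:
  assumes "c \<noteq> 0" "s \<in> diff_cone v"
  shows "c *s s \<in> diff_cone v"
proof -
  obtain c' x where x: "c' \<noteq> 0" "x \<in> z - {v}" "s = c' *s (x - v)" using assms(2) by (auto simp: diff_cone_def)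
  then show ?thesis using assms(1) unfolding diff_cone_def
    by (intro image_eqI[of _ _ "(c * c', x)"]) auto
qed

lemma zero_notin_diff_cone: "0 \<notin> diff_cone v"
  by (auto simp: diff_cone_def)

lemma card_diff_cone: "v \<in> z \<Longrightarrow> card (diff_cone v) \<le> (q - 1) * (N - 1)"
proof -
  assume v: "v \<in> z"
  have "card (diff_cone v) \<le> card ((- {0 :: 'a}) \<times> (z - {v}))"
    unfolding diff_cone_def by (rule card_image_le) simp
  also have "\<dots> = (q - 1) * (N - 1)" using v by (simp add: card_cartesian_product Compl_eq_Diff_UNIV q N)
  finally show ?thesis .
qed

lemma coset_avoiding_diff_cone:
  assumes "vec.subspace U" "U \<inter> diff_cone v = {}" "v \<in> z"
  shows "z \<inter> coset v U = {v}"
proof (intro equalityI subsetI)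
  fix x assume x: "x \<in> z \<inter> coset v U"
  show "x \<in> {v}"
  proof (rule ccontr)
    assume "x \<notin> {v}"
    then have "1 *s (x - v) \<in> diff_cone v" unfolding diff_cone_def using x
      by (intro image_eqI[of _ _ "(1, x)"]) auto
    then show False using assms x by (auto simp: coset_def)
  qed
qed (use assms coset_self in auto)

text \<open>If \<open>N \<le> Q\<close>, the difference cone of a point \<open>v\<close> of
  \<open>z\<close> is small enough to be avoided by some \<open>d\<close>-dimensional
  \<open>W\<close>. So every coset of \<open>W\<close> has 1 modulo \<open>q\<close> points, and the
  affine section, which then has no point outside \<open>z\<close>, fills \<open>z\<close> by
  cardinality, although \<open>z\<close> has a point off it.\<close>

lemma card_gt: "N > Q"
proof (rule ccontr)
  assume "\<not> N > Q"
  then have NQ: "N \<le> Q" by simp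
  obtain v where v: "v \<in> z" using nonempty by blast
  have "\<exists>W. vec.subspace W \<and> vec.dim W = d \<and> W \<inter> diff_cone v = {}"
  proof (rule subspace_avoiding_exists)
    assume d: "d > 0"
    have "card (diff_cone v) + 1 \<le> (q - 1) * (Q - 1) + 1"
      using card_diff_cone[OF v] NQ by (meson add_mono diff_le_mono mult_le_mono2 order_refl order_trans)
    also have "\<dots> < q * Q"
    proof -
      obtain q' Q' where "q = Suc q'" "Q = Suc Q'" using q_ge_2 Q_ge_q by (metis not0_implies_Suc not_numeral_le_zero order_trans)
      then show ?thesis using q_ge_2 by simp
    qed
    finally have "q ^ (d - 1) * (card (diff_cone v) + 1) < q ^ (d - 1) * (q * Q)"
      using q_ge_2 by (intro mult_strict_left_mono) simp_all
    also have "\<dots> = q ^ d * Q" using d by (cases d) auto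
    finally show "CARD('a) ^ (d - 1) * (card (diff_cone v) + 1) < CARD('a) ^ CARD('n)"
      unfolding card_space unfolding q[symmetric] .
  qed (use diff_cone_scale zero_notin_diff_cone in auto)
  then obtain W where W: "vec.subspace W" "vec.dim W = d" "W \<inter> diff_cone v = {}" by blast
  have "card (z \<inter> coset v W) = 1" using coset_avoiding_diff_cone[OF W(1,3) v] by simp
  then have one: "[card (z \<inter> coset u W) = 1] (mod q)" for u using card_cong[OF W(1,2), of u v] by simp
  obtain a V0 where V: "vec.subspace V0" "card (coset a V0) = Q" "N \<ge> Q + q * card (coset a V0 - z)"
    "z - coset a V0 \<noteq> {}"
    using affine_section[OF W(1,2) one] by metis
  have "card (coset a V0 - z) = 0" using V(3) NQ q_ge_2 by (metis add_le_same_cancel1 le_zero_eq mult_is_0 not_numeral_le_zero order_trans)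
  then have "coset a V0 \<subseteq> z" by auto
  then have "coset a V0 = z" using V(2) NQ N by (intro card_seteq) auto
  then show False using V(4) by blast
qed

section \<open>Fans of subspaces through a common point\<close>

text \<open>The spaces \<open>coset v (adjoin (v - y) U)\<close> for distinct \<open>y\<close> meet
  only in \<open>coset v U\<close>, whose single point of \<open>z\<close> is \<open>v\<close>. Each
  of them contributes \<open>M\<close> points of its own.\<close>

lemma fan_count:
  assumes U: "vec.subspace U" and V0: "vec.subspace V0"
    and v: "v \<in> z" "v - a \<notin> V0" and UH: "U \<inter> (adjoin (v - a) V0 - {0}) = {}"
    and one: "z \<inter> coset v U = {v}" and T: "T \<subseteq> coset a V0"
    and M: "\<And>y. y \<in> T \<Longrightarrow> card (z \<inter> coset v (adjoin (v - y) U)) \<ge> M + 1"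
  shows "N \<ge> 1 + M * card T"
proof -
  define R where "R y = z \<inter> coset v (adjoin (v - y) U) - {v}" for y
  have R: "card (R y) \<ge> M" if "y \<in> T" for y
  proof -
    have "v \<in> z \<inter> coset v (adjoin (v - y) U)" using v coset_self[OF subspace_adjoin[OF U]] by simp
    then show ?thesis using M[OF that] by (simp add: R_def)
  qed
  have "M * card T \<le> (\<Sum>y\<in>T. card (R y))" using sum_mono[of T "\<lambda>_. M", OF R] by (simp add: mult.commute)
  also have "\<dots> = card (\<Union>y\<in>T. R y)"
  proof (rule card_UN_disjoint[symmetric])
    show "\<forall>i\<in>T. \<forall>j\<in>T. i \<noteq> j \<longrightarrow> R i \<inter> R j = {}"
    proof (intro ballI impI)
      fix i j assume ij: "i \<in> T" "j \<in> T" "i \<noteq> j"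
      show "R i \<inter> R j = {}"
      proof (rule ccontr)
        assume "\<not> ?thesis"
        then obtain x where x: "x \<in> z" "x \<noteq> v" "x - v \<in> adjoin (v - i) U" "x - v \<in> adjoin (v - j) U"
          by (auto simp: R_def coset_def)
        have "x - v \<notin> U" using x one by (auto simp: coset_def)
        then have "i = j"
          using adjoin_disjoint[OF U V0 v(2) UH _ _ x(3,4)] ij T by (auto simp: coset_def)
        then show False using ij by simp
      qed
    qed
  qed auto
  also have "\<dots> \<le> card (z - {v})" by (intro card_mono) (auto simp: R_def)
  also have "\<dots> = N - 1" using v N by simp
  finally show ?thesis using N_pos by linarith
qed

lemma dim_adjoin_direction:
  assumes U: "vec.subspace U" "vec.dim U = d - 1" "d > 0" and V0: "vec.subspace V0"
    and v: "v - a \<notin> V0" and UH: "U \<inter> (adjoin (v - a) V0 - {0}) = {}" and y: "y \<in> coset a V0"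
  shows "vec.dim (adjoin (v - y) U) = d"
proof -
  have yV: "y - a \<in> V0" using y by (simp add: coset_def)
  have "v - y - 1 *s (v - a) \<in> V0" using vec.subspace_neg[OF V0 yV] by simp
  then have "v - y \<in> adjoin (v - a) V0" unfolding adjoin_def by blast
  moreover have "v - y \<noteq> 0" using v yV by auto
  ultimately have "v - y \<notin> U" using UH by blast
  then show ?thesis using dim_adjoin[OF U(1)] U by simp
qed

section \<open>The bound \<open>N \<ge> 2 * Q\<close> for \<open>q \<ge> 4\<close>\<close>

text \<open>If there were always three points, each \<open>w\<close> outside \<open>U\<close> would
  see two points \<open>x \<noteq> v\<close>. Conversely each \<open>x\<close> is seen by at most
  \<open>(q - 1) * q ^ (d - 1)\<close> vectors \<open>w\<close>, namely combinations of a nonzero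
  multiple of \<open>x - v\<close> and an element of \<open>U\<close>. Double counting contradicts
  \<open>N < 2 * Q\<close>.\<close>

lemma exists_coset_with_at_most_two:
  assumes U: "vec.subspace U" "vec.dim U = d - 1" and d0: "d > 0" and v: "v \<in> z"
    and Uone: "z \<inter> coset v U = {v}" and N2: "N < 2 * Q"
  shows "\<exists>w. w \<notin> U \<and> card (z \<inter> coset v (adjoin w U)) \<le> 2"
proof (rule ccontr)
  assume none: "\<not> ?thesis"
  have ge3: "card (z \<inter> coset v (adjoin w U)) \<ge> 3" if "w \<notin> U" for w
  proof -
    have "\<not> card (z \<inter> coset v (adjoin w U)) \<le> 2" using none that by blast
    then show ?thesis by simp
  qed
  have ge2: "2 \<le> (\<Sum>x\<in>z - {v}. if x - v \<in> adjoin w U then 1 else 0 :: nat)" if "w \<in> - U" for w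
  proof -
    have "(\<Sum>x\<in>z - {v}. if x - v \<in> adjoin w U then 1 else 0 :: nat)
        = card (z \<inter> coset v (adjoin w U) - {v})"
      unfolding sum_indicator_eq_card[OF finite]
      by (rule arg_cong[where f = card]) (auto simp: coset_def)
    also have "\<dots> = card (z \<inter> coset v (adjoin w U)) - 1"
      using v coset_self[OF subspace_adjoin[OF U(1)]] by simp
    finally show ?thesis using ge3[of w] that by simp
  qed
  have "2 * card (- U) \<le> (\<Sum>w\<in>-U. \<Sum>x\<in>z - {v}. if x - v \<in> adjoin w U then 1 else 0 :: nat)"
    using sum_mono[of "- U" "\<lambda>_. 2", OF ge2] by (simp add: mult.commute)
  also have "\<dots> = (\<Sum>x\<in>z - {v}. \<Sum>w\<in>-U. if x - v \<in> adjoin w U then 1 else 0 :: nat)"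
    by (rule sum.swap)
  also have "\<dots> \<le> (\<Sum>x\<in>z - {v}. (q - 1) * q ^ (d - 1))"
  proof (rule sum_mono)
    fix x assume x: "x \<in> z - {v}"
    have "{w \<in> - U. x - v \<in> adjoin w U} \<subseteq> (\<lambda>(c, u). c *s (x - v) + u) ` ((- {0}) \<times> U)"
    proof
      fix w assume w: "w \<in> {w \<in> - U. x - v \<in> adjoin w U}"
      then obtain c where c: "(x - v) - c *s w \<in> U" by (auto simp: adjoin_def)
      have c0: "c \<noteq> 0"
      proof
        assume "c = 0"
        then have "x \<in> z \<inter> coset v U" using c x by (simp add: coset_def)
        then show False using Uone x by auto
      qed
      have "- inverse c *s ((x - v) - c *s w) \<in> U" by (rule vec.subspace_scale[OF U(1) c])
      moreover have "w = inverse c *s (x - v) + - inverse c *s ((x - v) - c *s w)"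
        using c0 by (simp add: vec.scale_right_diff_distrib)
      ultimately show "w \<in> (\<lambda>(c, u). c *s (x - v) + u) ` ((- {0}) \<times> U)"
        using c0 by (intro image_eqI[of _ _ "(inverse c, - inverse c *s ((x - v) - c *s w))"]) auto
    qed
    then have "card {w \<in> - U. x - v \<in> adjoin w U} \<le> card ((- {0 :: 'a}) \<times> U)"
      by (intro surj_card_le) auto
    then show "(\<Sum>w\<in>-U. if x - v \<in> adjoin w U then 1 else 0 :: nat) \<le> (q - 1) * q ^ (d - 1)"
      unfolding sum_indicator_eq_card[OF finite]
      using U by (simp add: card_cartesian_product Compl_eq_Diff_UNIV card_subspace q)
  qed
  also have "\<dots> = (N - 1) * ((q - 1) * q ^ (d - 1))" using v N by simp
  finally have le: "2 * card (- U) \<le> (N - 1) * ((q - 1) * q ^ (d - 1))" .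
  have Q0: "Q \<ge> 1" using Q_ge_q q_ge_2 by simp
  have "card (- U) = q ^ d * Q - q ^ (d - 1)"
    using card_space U by (simp add: Compl_eq_Diff_UNIV card_Diff_subset card_subspace q)
  also have "\<dots> = q ^ (d - 1) * (q * Q - 1)" using d0 by (cases d) (auto simp: diff_mult_distrib2 ac_simps)
  finally have cU: "card (- U) = q ^ (d - 1) * (q * Q - 1)" .
  have "q ^ (d - 1) * (2 * (q * Q - 1)) = 2 * card (- U)" by (simp only: cU ac_simps)
  also note le
  also have "(N - 1) * ((q - 1) * q ^ (d - 1)) = q ^ (d - 1) * ((N - 1) * (q - 1))" by (simp only: ac_simps)
  finally have "q ^ (d - 1) * (2 * (q * Q - 1)) \<le> q ^ (d - 1) * ((N - 1) * (q - 1))" .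
  then have "2 * (q * Q - 1) \<le> (N - 1) * (q - 1)" using q_ge_2 by simp
  also have "\<dots> \<le> (2 * Q - 2) * (q - 1)" using N2 by (intro mult_right_mono) auto
  finally have "2 * (q * Q - 1) \<le> (2 * Q - 2) * (q - 1)" .
  moreover obtain q' where "q = Suc (Suc q')" using q_ge_2 by (metis add_2_eq_Suc le_Suc_ex)
  moreover obtain Q' where "Q = Suc Q'" using Q0 by (cases Q) auto
  ultimately show False by simp
qed

text \<open>If \<open>N < 2 * Q\<close>, a coset of a \<open>d\<close>-dimensional space has fewer
  than two points or at least \<open>q\<close>. A coset with one point produces the affine section
  \<open>V\<close>, and a fan from a point \<open>x\<close> of \<open>z\<close> off \<open>V\<close>
  over the points of \<open>V\<close> in \<open>z\<close> has at least \<open>q - 1\<close> further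
  points in each member.\<close>

lemma card_ge_twice:
  assumes q4: "q \<ge> 4"
  shows "N \<ge> 2 * Q"
proof (rule ccontr)
  assume "\<not> N \<ge> 2 * Q"
  then have N2: "N < 2 * Q" by simp
  have Q0: "Q \<ge> 1" using Q_ge_q q_ge_2 by simp
  have d0: "d > 0"
  proof (rule ccontr)
    assume "\<not> d > 0"
    then have "CARD('a) ^ CARD('n) = Q" using card_space by simp
    moreover have "N \<le> CARD('a) ^ CARD('n)"
      unfolding N using card_mono[of UNIV z] by simp
    ultimately show False using card_gt by simp
  qed
  \<comment> \<open>A number of points strictly between 1 and \<open>q\<close> would be the residue
    modulo \<open>q\<close> for all cosets, which would then all have at least two points, giving
    \<open>N \<ge> 2 * Q\<close>.\<close>
  have small: "c < 2 \<or> q \<le> c" if "vec.subspace W" "vec.dim W = d" "c = card (z \<inter> coset u W)" for W u c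
  proof (rule ccontr)
    assume "\<not> ?thesis"
    then have c: "2 \<le> c" "c < q" by auto
    have "card (z \<inter> coset u' W) \<ge> 2" for u'
    proof -
      have "[card (z \<inter> coset u' W) = c] (mod q)" using card_cong[OF that(1,2)] that(3) by simp
      then have "card (z \<inter> coset u' W) mod q = c" using c by (simp add: cong_def)
      then show ?thesis using c(1) mod_less_eq_dividend[of "card (z \<inter> coset u' W)" q] by linarith
    qed
    then have "N \<ge> 2 * Q" by (rule card_le_mult_of_coset_bound[OF that(1,2)])
    then show False using N2 by simp
  qed
  \<comment> \<open>For dimension \<open>d - 1\<close> the room for the set to be avoided is
    \<open>q ^ (n - d + 2) = q * (q * Q)\<close>, with \<open>n\<close> the dimension of the whole
    space.\<close>
  have avoid: "\<exists>U. vec.subspace U \<and> vec.dim U = d - 1 \<and> U \<inter> S = {}"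
    if S: "\<And>c s. c \<noteq> 0 \<Longrightarrow> s \<in> S \<Longrightarrow> c *s s \<in> S" "0 \<notin> S" and cS: "card S + 1 < q * (q * Q)" for S :: "('a ^ 'n) set"
  proof (rule subspace_avoiding_exists)
    assume "d - 1 > 0"
    have "q ^ (d - 1 - 1) * (card S + 1) < q ^ (d - 1 - 1) * (q * (q * Q))"
      using cS q_ge_2 by (intro mult_strict_left_mono) simp_all
    also have "\<dots> = q ^ d * Q"
    proof -
      obtain e where "d = Suc (Suc e)" using \<open>d - 1 > 0\<close> by (metis Suc_pred d0 diff_Suc_1)
      then show ?thesis by simp
    qed
    finally show "CARD('a) ^ (d - 1 - 1) * (card S + 1) < CARD('a) ^ CARD('n)"
      unfolding card_space unfolding q[symmetric] .
  qed (use S in auto)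
  have cone: "card (diff_cone v) \<le> (q - 1) * (2 * Q - 2)" if "v \<in> z" for v
  proof -
    have "N - 1 \<le> 2 * Q - 2" using N2 by simp
    then have "(q - 1) * (N - 1) \<le> (q - 1) * (2 * Q - 2)" by (rule mult_left_mono) simp
    then show ?thesis using card_diff_cone[OF that] by linarith
  qed
  obtain v where v: "v \<in> z" using nonempty by blast
  have "\<exists>U. vec.subspace U \<and> vec.dim U = d - 1 \<and> U \<inter> diff_cone v = {}"
  proof (rule avoid)
    have "(q - 1) * (2 * Q - 2) + 1 \<le> (q - 1) * (2 * Q) + 1" by simp
    also have "\<dots> < 2 * q * Q" using q4 Q0 by (simp add: diff_mult_distrib algebra_simps) (cases q; cases Q; simp)
    also have "\<dots> \<le> q * (q * Q)" using q_ge_2 by simp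
    finally show "card (diff_cone v) + 1 < q * (q * Q)" using cone[OF v] by linarith
  qed (use diff_cone_scale zero_notin_diff_cone in auto)
  then obtain U where U: "vec.subspace U" "vec.dim U = d - 1" "U \<inter> diff_cone v = {}" by blast
  have Uone: "z \<inter> coset v U = {v}" by (rule coset_avoiding_diff_cone[OF U(1,3) v])
  have "\<exists>w. w \<notin> U \<and> card (z \<inter> coset v (adjoin w U)) \<le> 2"
    by (rule exists_coset_with_at_most_two[OF U(1,2) d0 v Uone N2])
  then obtain w where w: "w \<notin> U" "card (z \<inter> coset v (adjoin w U)) \<le> 2" by blast
  define W where "W = adjoin w U"
  have W: "vec.subspace W" "vec.dim W = d"
    using subspace_adjoin[OF U(1)] dim_adjoin[OF U(1) w(1)] U(2) d0 by (auto simp: W_def)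
  have "v \<in> z \<inter> coset v W" using v coset_self[OF W(1)] by simp
  then have "card (z \<inter> coset v W) > 0" by (metis card_gt_0_iff empty_iff finite)
  then have "card (z \<inter> coset v W) = 1"
    using small[OF W refl, of v] w(2)[folded W_def] q4 by linarith
  then have one: "[card (z \<inter> coset u W) = 1] (mod q)" for u using card_cong[OF W, of u v] by simp
  obtain a V0 where V0: "vec.subspace V0" and cV: "card (coset a V0) = Q"
    and ineq: "N \<ge> Q + q * card (coset a V0 - z)" and ne: "z - coset a V0 \<noteq> {}"
    using affine_section[OF W one] by metis
  obtain x where x: "x \<in> z" "x - a \<notin> V0" using ne by (auto simp: coset_def)
  define H where "H = adjoin (x - a) V0"
  have H: "vec.subspace H" unfolding H_def by (rule subspace_adjoin[OF V0])
  have "card V0 = Q" using cV card_coset[OF V0] card_subspace[OF V0] by simp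
  then have cH: "card H \<le> q * Q" using card_adjoin_le[of "x - a" V0] by (simp add: H_def q)
  have "\<exists>U. vec.subspace U \<and> vec.dim U = d - 1 \<and> U \<inter> (diff_cone x \<union> (H - {0})) = {}"
  \<comment> \<open>Avoiding \<open>diff_cone x\<close> isolates \<open>x\<close> in its coset, and
    avoiding \<open>H - {0}\<close> keeps the members of the fan apart.\<close>
  proof (rule avoid)
    show "c *s s \<in> diff_cone x \<union> (H - {0})" if "c \<noteq> 0" "s \<in> diff_cone x \<union> (H - {0})" for c s
      using that diff_cone_scale vec.subspace_scale[OF H] by auto
    have "card (diff_cone x \<union> (H - {0})) \<le> card (diff_cone x) + card (H - {0})" by (rule card_Un_le)
    moreover have "card (H - {0}) \<le> q * Q - 1" using cH vec.subspace_0[OF H] by simp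
    moreover have "(q - 1) * (2 * Q - 2) + (q * Q - 1) + 1 < q * (q * Q)"
    proof -
      have "q * Q \<ge> 1" using q_ge_2 Q0 by simp
      then have "(q - 1) * (2 * Q - 2) + (q * Q - 1) + 1 = (q - 1) * (2 * Q - 2) + q * Q" by simp
      also have "\<dots> \<le> q * (2 * Q) + q * Q" by (intro add_right_mono mult_mono) auto
      also have "\<dots> = 3 * (q * Q)" by simp
      also have "\<dots> < q * (q * Q)" using q4 \<open>q * Q \<ge> 1\<close> by (intro mult_strict_right_mono) auto
      finally show ?thesis .
    qed
    ultimately show "card (diff_cone x \<union> (H - {0})) + 1 < q * (q * Q)" using cone[OF x(1)] by linarith
  qed (use zero_notin_diff_cone in auto)
  then obtain U' where U': "vec.subspace U'" "vec.dim U' = d - 1" "U' \<inter> diff_cone x = {}"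
    "U' \<inter> (H - {0}) = {}" by blast
  have U'one: "z \<inter> coset x U' = {x}" by (rule coset_avoiding_diff_cone[OF U'(1,3) x(1)])
  have "N \<ge> 1 + (q - 1) * card (coset a V0 \<inter> z)"
  proof (rule fan_count[OF U'(1) V0 x U'(4)[unfolded H_def] U'one])
    fix y assume y: "y \<in> coset a V0 \<inter> z"
    define A where "A = adjoin (x - y) U'"
    have A: "vec.subspace A" "vec.dim A = d"
      using subspace_adjoin[OF U'(1)] dim_adjoin_direction[OF U'(1,2) d0 V0 x(2) U'(4)[unfolded H_def], of y] y
      by (auto simp: A_def)
    have "x - y \<in> A" unfolding A_def by (rule adjoin_mem[OF U'(1)])
    then have "y - x \<in> A" using vec.subspace_neg[OF A(1)] by fastforce
    then have "{x, y} \<subseteq> z \<inter> coset x A" using x y coset_self[OF A(1)] by (auto simp: coset_def)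
    moreover have "x \<noteq> y" using x y by (auto simp: coset_def)
    ultimately have "card (z \<inter> coset x A) \<ge> 2" using card_mono[of "z \<inter> coset x A" "{x, y}"] by simp
    then have "card (z \<inter> coset x A) \<ge> q" using small[OF A refl, of x] by linarith
    then show "card (z \<inter> coset x (adjoin (x - y) U')) \<ge> q - 1 + 1" using q_ge_2 by (simp add: A_def)
  qed simp
  moreover have "Q = card (coset a V0 \<inter> z) + card (coset a V0 - z)"
    using cV card_Int_Diff[of "coset a V0" z] by simp
  moreover define t b where "t = card (coset a V0 \<inter> z)" and "b = card (coset a V0 - z)"
  ultimately have 1: "N \<ge> 1 + (q - 1) * t" "Q = t + b" "N \<ge> Q + q * b" using ineq by auto
  \<comment> \<open>With \<open>Q = t + b\<close> the section bound yields \<open>3 * b < t\<close>,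
    whereas the fan bound yields \<open>t < 2 * b\<close>.\<close>
  obtain r where r: "q = r + 4" using q4 by (metis le_add_diff_inverse2)
  have "(q - 1) * b < t" using 1(2,3) N2 q_ge_2 by (cases q) auto
  then have "3 * b < t" using mult_right_mono[of 3 "q - 1" b] r by linarith
  moreover have "3 * t < 2 * t + 2 * b"
    using 1(1,2) N2 mult_right_mono[of 3 "q - 1" t] r by linarith
  ultimately show False by linarith
qed

section \<open>The bound for cones\<close>

text \<open>The origin serves as the isolated point, so the affine section is a linear space
  \<open>V0\<close>. A fan from a point \<open>v\<close> of \<open>z\<close> off \<open>V0\<close>
  gives \<open>q\<close> further points for each \<open>y\<close> in \<open>V0 \<inter> z\<close>,
  apart from the bad ones. There are few bad \<open>y\<close> because a cone contains all multiples
  of its points.\<close>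

lemma cone_card_bound:
  assumes cone: "\<And>c x. x \<in> z \<Longrightarrow> c *s x \<in> z"
  shows "(m + 2) * N \<ge> q * Q"
proof (rule ccontr)
  assume "\<not> (m + 2) * N \<ge> q * Q"
  then have small: "(m + 2) * N < q * Q" by simp
  have Q0: "Q \<ge> 1" using Q_ge_q q_ge_2 by simp
  have z0: "0 \<in> z" using nonempty cone[of _ 0] by auto
  have "3 * N \<le> (m + 2) * N" using m_pos by (intro mult_right_mono) auto
  then have small3: "3 * N < q * Q" using small by linarith
  have d0: "d > 0"
  proof (rule ccontr)
    assume "\<not> d > 0"
    then have "CARD('a) ^ CARD('n) = Q" using card_space by simp
    moreover have "N \<le> CARD('a) ^ CARD('n)"
      unfolding N using card_mono[of UNIV z] by simp
    ultimately show False using card_gt by simp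
  qed
  have "\<exists>W. vec.subspace W \<and> vec.dim W = d \<and> W \<inter> (z - {0}) = {}"
  proof (rule subspace_avoiding_exists)
    have "card (z - {0}) + 1 = N" using z0 N N_pos by simp
    then have "q ^ (d - 1) * (card (z - {0}) + 1) < q ^ (d - 1) * (q * Q)"
      using q_ge_2 small3 by (intro mult_strict_left_mono) simp_all
    also have "\<dots> = q ^ d * Q" using d0 by (cases d) auto
    finally show "CARD('a) ^ (d - 1) * (card (z - {0}) + 1) < CARD('a) ^ CARD('n)"
      unfolding card_space unfolding q[symmetric] .
  qed (use cone in auto)
  then obtain W where W: "vec.subspace W" "vec.dim W = d" "W \<inter> (z - {0}) = {}" by blast
  have zW: "z \<inter> coset 0 W = {0}" using W z0 vec.subspace_0[OF W(1)] by auto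
  then have "card (z \<inter> coset 0 W) = 1" by simp
  then have one: "[card (z \<inter> coset u W) = 1] (mod q)" for u using card_cong[OF W(1,2), of u 0] by simp
  obtain a V0 where V0: "vec.subspace V0" and cV: "card (coset a V0) = Q"
    and ineq: "N \<ge> Q + q * card (coset a V0 - z)"
    and mem: "\<And>u x. z \<inter> coset u W = {x} \<Longrightarrow> x \<in> coset a V0" and ne: "z - coset a V0 \<noteq> {}"
    using affine_section[OF W(1,2) one] by metis
  \<comment> \<open>The origin is the only point of \<open>z\<close> in \<open>W\<close>, so the
    section passes through it.\<close>
  have "0 - a \<in> V0" using mem[OF zW] by (simp add: coset_def)
  then have aV: "coset a V0 = V0" using coset_eq_iff[OF V0, of 0 a] by simp
  obtain v where v: "v \<in> z" "v - 0 \<notin> V0" using ne aV by auto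
  define H where "H = adjoin (v - 0) V0"
  have H: "vec.subspace H" unfolding H_def by (rule subspace_adjoin[OF V0])
  have cH: "card H \<le> q * Q" using card_adjoin_le[of "v - 0" V0] cV aV by (simp add: H_def q)
  have "\<exists>U. vec.subspace U \<and> vec.dim U = d - 1 \<and> U \<inter> ((z - {0}) \<union> diff_cone v \<union> (H - {0})) = {}"
  proof (rule subspace_avoiding_exists)
    show "c *s s \<in> (z - {0}) \<union> diff_cone v \<union> (H - {0})"
      if "c \<noteq> 0" "s \<in> (z - {0}) \<union> diff_cone v \<union> (H - {0})" for c s
      using that diff_cone_scale vec.subspace_scale[OF H] cone by auto
    assume "d - 1 > 0"
    let ?S = "(z - {0}) \<union> diff_cone v \<union> (H - {0})"
    have "card ?S \<le> card (z - {0}) + card (diff_cone v) + card (H - {0})"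
      using card_Un_le[of "(z - {0}) \<union> diff_cone v" "H - {0}"] card_Un_le[of "z - {0}" "diff_cone v"] by linarith
    moreover have "card (H - {0}) \<le> q * Q - 1" using cH vec.subspace_0[OF H] by simp
    moreover have "card (z - {0}) = N - 1" using z0 N by simp
    moreover have "q * Q \<ge> 1" using q_ge_2 Q0 by simp
    ultimately have "card ?S + 1 \<le> (N - 1) + (q - 1) * (N - 1) + q * Q"
      using card_diff_cone[OF v(1)] by linarith
    also have "(N - 1) + (q - 1) * (N - 1) = q * (N - 1)" using q_ge_2 by (cases q) auto
    also have "q * (N - 1) + q * Q = q * (N - 1 + Q)" by (simp add: distrib_left)
    also have "\<dots> < q * (q * Q)"
    proof (intro mult_strict_left_mono)
      have "2 * Q \<le> q * Q" using q_ge_2 by simp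
      then show "N - 1 + Q < q * Q" using small3 N_pos by linarith
    qed (use q_ge_2 in simp)
    finally have "q ^ (d - 1 - 1) * (card ?S + 1) < q ^ (d - 1 - 1) * (q * (q * Q))"
      using q_ge_2 by (intro mult_strict_left_mono) simp_all
    also have "\<dots> = q ^ d * Q"
    proof -
      obtain e where "d = Suc (Suc e)" using \<open>d - 1 > 0\<close> by (metis Suc_pred d0 diff_Suc_1)
      then show ?thesis by simp
    qed
    finally show "CARD('a) ^ (d - 1 - 1) * (card ?S + 1) < CARD('a) ^ CARD('n)"
      unfolding card_space unfolding q[symmetric] .
  qed (use zero_notin_diff_cone in auto)
  then obtain U where U: "vec.subspace U" "vec.dim U = d - 1" "U \<inter> (z - {0}) = {}"
    "U \<inter> diff_cone v = {}" "U \<inter> (H - {0}) = {}" by blast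
  note UH = U(5)[unfolded H_def]
  have Uone: "z \<inter> coset v U = {v}" by (rule coset_avoiding_diff_cone[OF U(1,4) v(1)])
  \<comment> \<open>For bad \<open>y\<close> the linear member of the fan has further points of
    \<open>z\<close>, and the residue 1 cannot be read off at the origin.\<close>
  define bad where "bad = {y \<in> V0. z \<inter> adjoin (v - y) U \<noteq> {0}}"
  define T where "T = (V0 \<inter> z) - bad"
  \<comment> \<open>For \<open>y\<close> in \<open>T\<close> the linear space has one point of
    \<open>z\<close>. Its translate through \<open>v\<close> thus has 1 modulo \<open>q\<close>
    points, and as it contains both \<open>v\<close> and \<open>y\<close> it has at least
    \<open>q + 1\<close>.\<close>
  have fan: "N \<ge> 1 + q * card T"
  proof (rule fan_count[OF U(1) V0 v UH Uone])
    show "T \<subseteq> coset 0 V0" by (auto simp: T_def)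
    fix y assume "y \<in> T"
    then have y: "y \<in> V0" "y \<in> z" "z \<inter> adjoin (v - y) U = {0}" by (auto simp: T_def bad_def)
    define A where "A = adjoin (v - y) U"
    have A: "vec.subspace A" "vec.dim A = d"
      using subspace_adjoin[OF U(1)] dim_adjoin_direction[OF U(1,2) d0 V0 v(2) UH, of y] y
      by (auto simp: A_def)
    have "card (z \<inter> coset 0 A) = 1" using y(3) by (simp add: A_def)
    then have cA: "[card (z \<inter> coset v A) = 1] (mod q)" using card_cong[OF A, of v 0] by simp
    have "v - y \<in> A" unfolding A_def by (rule adjoin_mem[OF U(1)])
    then have "y - v \<in> A" using vec.subspace_neg[OF A(1)] by fastforce
    then have "{v, y} \<subseteq> z \<inter> coset v A" using v y coset_self[OF A(1)] by (auto simp: coset_def)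
    moreover have "v \<noteq> y" using v y by auto
    ultimately have "card (z \<inter> coset v A) \<ge> 2" using card_mono[of "z \<inter> coset v A" "{v, y}"] by simp
    then show "card (z \<inter> coset v (adjoin (v - y) U)) \<ge> q + 1"
      using cong_1_card_ge[OF cA _ q_ge_2] by (simp add: A_def)
  qed
  \<comment> \<open>One nonzero point of \<open>z\<close> is chosen for each bad \<open>y\<close>.
    Its nonzero multiples stay in \<open>z\<close>, avoid \<open>U\<close>, and are distinct for
    distinct \<open>y\<close>.\<close>
  have bad: "(q - 1) * card bad \<le> N"
  proof -
    have "\<exists>x. x \<in> z \<and> x \<noteq> 0 \<and> x \<in> adjoin (v - y) U" if "y \<in> bad" for y
    proof -
      have "0 \<in> z \<inter> adjoin (v - y) U" using z0 vec.subspace_0[OF subspace_adjoin[OF U(1)]] by simp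
      then show ?thesis using that by (auto simp: bad_def)
    qed
    then obtain g where g: "\<And>y. y \<in> bad \<Longrightarrow> g y \<in> z \<and> g y \<noteq> 0 \<and> g y \<in> adjoin (v - y) U" by metis
    have "inj_on (\<lambda>(c, y). c *s g y) ((- {0}) \<times> bad)"
    proof (rule inj_onI)
      fix s t
      assume st: "s \<in> (- {0}) \<times> bad" "t \<in> (- {0}) \<times> bad"
        and st_eq: "(\<lambda>(c, y). c *s g y) s = (\<lambda>(c, y). c *s g y) t"
      obtain c1 y1 c2 y2 where st_def: "s = (c1, y1)" "t = (c2, y2)" by (metis surj_pair)
      have c: "c1 \<noteq> 0" "c2 \<noteq> 0" and y: "y1 \<in> bad" "y2 \<in> bad" and e: "c1 *s g y1 = c2 *s g y2"
        using st st_eq by (auto simp: st_def)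
      have "c1 *s g y1 \<in> adjoin (v - y1) U" "c2 *s g y2 \<in> adjoin (v - y2) U"
        using g[OF y(1)] g[OF y(2)] vec.subspace_scale[OF subspace_adjoin[OF U(1)]] by auto
      moreover have "c1 *s g y1 \<notin> U"
        using g[OF y(1)] cone[of "g y1" c1] c(1) U(3) by auto
      ultimately have "y1 = y2"
        using adjoin_disjoint[OF U(1) V0 v(2) UH, of y1 y2 "c1 *s g y1"] y e by (auto simp: bad_def)
      then show "s = t" using e g[OF y(1)] by (simp add: st_def)
    qed
    then have "card ((- {0 :: 'a}) \<times> bad) = card ((\<lambda>(c, y). c *s g y) ` ((- {0}) \<times> bad))"
      by (rule card_image[symmetric])
    also have "\<dots> \<le> card z" using g cone by (intro card_mono) auto
    finally show ?thesis by (simp add: card_cartesian_product Compl_eq_Diff_UNIV q N)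
  qed
  define b where "b = card (V0 - z)"
  define \<beta> where "\<beta> = card bad"
  have "Q = card (V0 \<inter> z) + b" using cV aV card_Int_Diff[of V0 z] by (simp add: b_def)
  moreover have "card (V0 \<inter> z) \<le> card T + \<beta>"
    unfolding T_def \<beta>_def by (rule order_trans[OF _ card_Un_le[of _ bad]]) (intro card_mono, auto)
  ultimately have T: "Q \<le> card T + \<beta> + b" by simp
  have bad': "(q - 1) * \<beta> \<le> N" using bad by (simp add: \<beta>_def)
  have b: "(m + 2) * b < Q"
  proof -
    have "q * b \<le> N" using ineq aV by (simp add: b_def)
    then have "(m + 2) * (q * b) \<le> (m + 2) * N" by (rule mult_left_mono) simp
    also have "(m + 2) * (q * b) = q * ((m + 2) * b)" by (simp only: ac_simps)
    finally have "q * ((m + 2) * b) < q * Q" using small by (rule le_less_trans)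
    then show ?thesis by (simp only: mult_less_cancel1)
  qed
  have NT: "1 + q * Q \<le> N + q * \<beta> + q * b"
    using fan mult_left_mono[OF T, of q] by (simp add: distrib_left)
  \<comment> \<open>For \<open>m \<ge> 2\<close>, multiplying \<open>NT\<close> by
    \<open>m + 2 \<ge> 4\<close> gives a contradiction, since the three terms on the right are
    bounded by \<open>q * Q\<close>, \<open>2 * (q * Q)\<close> and \<open>q * Q\<close>, the first
    one strictly. For \<open>m = 1\<close> the factor is only 3, but \<open>V0\<close> is a line:
    \<open>V0 - z\<close> is stable under nonzero scalars, so it is empty or has at least
    \<open>q - 1\<close> points, and the bound on \<open>b\<close> rules out the latter.\<close>
  show False
  proof (cases "m = 1")
    case True
    then have Qq: "Q = q" by (simp add: Q)
    have "b = 0"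
    proof (rule ccontr)
      assume "b \<noteq> 0"
      then obtain y where y: "y \<in> V0" "y \<notin> z" by (auto simp: b_def)
      then have y0: "y \<noteq> 0" using z0 by auto
      have "(\<lambda>c. c *s y) ` (- {0}) \<subseteq> V0 - z"
      proof (rule image_subsetI)
        fix c :: 'a assume "c \<in> - {0}"
        then have "c \<noteq> 0" by simp
        have "c *s y \<in> V0" by (rule vec.subspace_scale[OF V0 y(1)])
        moreover have "c *s y \<notin> z"
        proof
          assume "c *s y \<in> z"
          then have "inverse c *s (c *s y) \<in> z" by (rule cone)
          then show False using \<open>c \<noteq> 0\<close> y by simp
        qed
        ultimately show "c *s y \<in> V0 - z" by blast
      qed
      then have "card ((\<lambda>c. c *s y) ` (- {0 :: 'a})) \<le> b" unfolding b_def by (intro card_mono) auto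
      moreover have "inj_on (\<lambda>c. c *s y) (- {0 :: 'a})" using y0 by (auto intro: inj_onI)
      ultimately have "q - 1 \<le> b" by (simp add: card_image Compl_eq_Diff_UNIV q)
      then show False using b Qq True q_ge_2 by simp
    qed
    then have 1: "1 + q * q \<le> N + q * \<beta>" "3 * N < q * q" using NT small Qq True by auto
    then have "2 * (q * q) < 3 * (q * \<beta>)" by linarith
    then have "q * (2 * q) < q * (3 * \<beta>)" by (simp only: ac_simps)
    then have "2 * q < 3 * \<beta>" using q_ge_2 by simp
    then have "(q - 1) * (2 * q) \<le> (q - 1) * (3 * \<beta>)" by (intro mult_left_mono) auto
    also have "\<dots> \<le> 3 * N" using bad' by simp
    finally have "(q - 1) * (2 * q) < q * q" using 1(2) by (rule le_less_trans)
    moreover have "q * q \<le> 2 * (q - 1) * q" using q_ge_2 by (intro mult_right_mono) auto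
    then have "q * q \<le> (q - 1) * (2 * q)" by (simp only: ac_simps)
    ultimately show False by linarith
  next
    case False
    then have m2: "m + 2 \<ge> 4" using m_pos by simp
    define s where "s = m + 2"
    have s4: "s \<ge> 4" using m2 by (simp add: s_def)
    have "(q - 1) * (s * \<beta>) \<le> s * N" using mult_left_mono[OF bad', of s] by (simp add: ac_simps)
    then have "(q - 1) * (s * \<beta>) < q * Q" using small by (simp add: s_def)
    also have "\<dots> \<le> 2 * (q - 1) * Q" using q_ge_2 by (intro mult_right_mono) auto
    finally have "(q - 1) * (s * \<beta>) < (q - 1) * (2 * Q)" by (simp add: ac_simps)
    then have "s * \<beta> < 2 * Q" by simp
    then have "q * (s * \<beta>) \<le> q * (2 * Q)" by (intro mult_left_mono) auto
    then have "q * (s * \<beta>) \<le> 2 * (q * Q)" by (simp only: ac_simps)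
    moreover have "q * (s * b) \<le> q * Q" using b by (intro mult_left_mono) (auto simp: s_def)
    moreover have "s * (1 + q * Q) \<le> s * (N + q * \<beta> + q * b)" by (rule mult_left_mono[OF NT]) simp
    then have "s + s * (q * Q) \<le> s * N + q * (s * \<beta>) + q * (s * b)" by (simp add: algebra_simps)
    moreover have "4 * (q * Q) \<le> s * (q * Q)" using s4 by (rule mult_right_mono) simp
    moreover have "s * N < q * Q" using small by (simp add: s_def)
    ultimately show False using s4 by linarith
  qed
qed

end

section \<open>Application to systems of polynomials\<close>

lemma mpoly_eval_homogeneous_scale:
  assumes "homogeneous f" "mpoly_eval f x = 0"
  shows "mpoly_eval f (c *s x) = (0::'a::field)"
proof -
  obtain k where k: "\<And>m. m \<in> Poly_Mapping.keys f \<Longrightarrow> monomial_degree m = k"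
    using assms(1) by (auto simp: homogeneous_def)
  have "mpoly_eval f (c *s x) = (\<Sum>m\<in>Poly_Mapping.keys f. c ^ k *
      (Poly_Mapping.lookup f m * (\<Prod>i\<in>UNIV. (x $ i) ^ Poly_Mapping.lookup m i)))"
    unfolding mpoly_eval_def
  proof (intro sum.cong refl)
    fix m assume "m \<in> Poly_Mapping.keys f"
    then have "(\<Prod>i\<in>UNIV. c ^ Poly_Mapping.lookup m i) = c ^ k"
      using k by (simp add: monomial_degree_def flip: power_sum)
    then show "Poly_Mapping.lookup f m * (\<Prod>i\<in>UNIV. ((c *s x) $ i) ^ Poly_Mapping.lookup m i)
        = c ^ k * (Poly_Mapping.lookup f m * (\<Prod>i\<in>UNIV. (x $ i) ^ Poly_Mapping.lookup m i))"
      by (simp add: power_mult_distrib prod.distrib)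
  qed
  also have "\<dots> = c ^ k * mpoly_eval f x" by (simp add: mpoly_eval_def sum_distrib_left)
  finally show ?thesis using assms(2) by simp
qed

theorem theorem2:
  fixes f :: "nat \<Rightarrow> ('n::finite, 'a::{field,finite}) mpolynomial"
    and r n d q N :: nat
    and z :: "('a ^ 'n) set"
  assumes q_def: "q = CARD('a)"
    and n_def: "n = CARD('n)"
    and d_def: "d = (\<Sum>i=1..r. total_degree (f i))"
    and z_def: "z = common_zeros r f"
    and N_def: "N = card z"
    and "n > d"
    and "z \<noteq> {}"
    and "\<not> affine_linear_subspace z"
  shows "N > q ^ (n - d) \<and>
         (q \<ge> 4 \<longrightarrow> N \<ge> 2 * q ^ (n - d)) \<and>
         ((\<forall>i\<in>{1..r}. homogeneous (f i)) \<longrightarrow>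
            real N \<ge> real q ^ (n + 1 - d) / real (n + 2 - d))"
proof -
  have subsp: "(\<Sum>i=1..r. total_degree (f i)) \<le> vec.dim W" if "vec.dim W = d" for W :: "('a ^ 'n) set"
    using that d_def by simp
  interpret chevalley_warning_set z d "n - d" q "q ^ (n - d)" N
  proof
    show "q = CARD('a)" "CARD('n) = d + (n - d)" "N = card z" "n - d > 0" "z \<noteq> {}"
      "\<not> affine_linear_subspace z"
      using assms by auto
    fix W :: "('a ^ 'n) set" and u v c
    assume W: "vec.subspace W" "vec.dim W = d"
    show "[card (z \<inter> coset u W) = card (z \<inter> coset v W)] (mod q)"
      unfolding z_def q_def by (rule card_common_zeros_coset_cong[OF W(1) subsp[OF W(2)]])
    show "\<Sum>(z \<inter> coset (u + v) W) + \<Sum>(z \<inter> coset 0 W) = \<Sum>(z \<inter> coset u W) + \<Sum>(z \<inter> coset v W)"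
      "\<Sum>(z \<inter> coset (c *s u) W) - \<Sum>(z \<inter> coset 0 W)
        = c *s (\<Sum>(z \<inter> coset u W) - \<Sum>(z \<inter> coset 0 W))"
      unfolding z_def by (rule sum_common_zeros_coset_affine[OF W(1) subsp[OF W(2)]])+
  qed simp
  have "real N \<ge> real q ^ (n + 1 - d) / real (n + 2 - d)" if hom: "\<forall>i\<in>{1..r}. homogeneous (f i)"
  proof -
    have "c *s x \<in> z" if "x \<in> z" for c x
      using mpoly_eval_homogeneous_scale hom that by (fastforce simp: z_def common_zeros_def)
    then have "q * q ^ (n - d) \<le> (n - d + 2) * N" by (rule cone_card_bound)
    moreover have "n + 1 - d = Suc (n - d)" "n + 2 - d = n - d + 2" using \<open>n > d\<close> by auto
    ultimately have "real (q ^ (n + 1 - d)) \<le> real (N * (n + 2 - d))"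
      by (simp only: of_nat_le_iff power_Suc mult.commute)
    then show ?thesis using \<open>n > d\<close> by (simp add: divide_le_eq)
  qed
  then show ?thesis using card_gt card_ge_twice by blast
qed

end
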